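(* The $C^*$-subalgebra $C^*(U)$ of $\mathcal{Q}_2$ generated by $U$ is a maximal abelian $C^*$-subalgebra of $\mathcal{Q}_2$.
   Context: The $2$-adic ring $C^*$-algebra $\mathcal{Q}_2$ is the universal (unital) $C^*$-algebra generated by a unitary $U$ and an isometry $S_2$ satisfying $S_2U=U^2S_2$ and $S_2S_2^*+US_2S_2^*U^*=1$. *)

theory Defs
  imports "HOL-Analysis.Analysis" "HOL-Library.Poly_Mapping"
begin

section \<open>Unital C*-algebras\<close>

text \<open>The axiom \<open>0 \<noteq> 1\<close> is not imposed, so the zero algebra counts as a unital C*-algebra; hence
  \<open>real_normed_algebra\<close> together with \<open>monoid_mult\<close> instead of \<open>real_normed_algebra_1\<close>.\<close>

class cstar_algebra = real_normed_algebra + monoid_mult + banach +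
  fixes scaleC :: "complex \<Rightarrow> 'a \<Rightarrow> 'a"  (infixr "*\<^sub>C" 75)
    and star :: "'a \<Rightarrow> 'a"
  assumes scaleC_add_right: "c *\<^sub>C (x + y) = c *\<^sub>C x + c *\<^sub>C y"
    and scaleC_add_left: "(c + d) *\<^sub>C x = c *\<^sub>C x + d *\<^sub>C x"
    and scaleC_scaleC: "c *\<^sub>C (d *\<^sub>C x) = (c * d) *\<^sub>C x"
    and scaleC_of_real: "complex_of_real r *\<^sub>C x = r *\<^sub>R x"
    and norm_scaleC: "norm (c *\<^sub>C x) = cmod c * norm x"
    and mult_scaleC_left: "(c *\<^sub>C x) * y = c *\<^sub>C (x * y)"
    and mult_scaleC_right: "x * (c *\<^sub>C y) = c *\<^sub>C (x * y)"
    and star_add: "star (x + y) = star x + star y"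
    and star_scaleC: "star (c *\<^sub>C x) = cnj c *\<^sub>C star x"
    and star_mult: "star (x * y) = star y * star x"
    and star_star: "star (star x) = x"
    and cstar_identity: "norm (star x * x) = (norm x)\<^sup>2"

definition cstar_subalgebra :: "'a::cstar_algebra set \<Rightarrow> bool"
  where "cstar_subalgebra B \<longleftrightarrow>
    0 \<in> B \<and>
    (\<forall>x\<in>B. \<forall>y\<in>B. x + y \<in> B \<and> x * y \<in> B) \<and>
    (\<forall>c. \<forall>x\<in>B. c *\<^sub>C x \<in> B) \<and>
    (\<forall>x\<in>B. star x \<in> B) \<and>
    closed B"

definition cstar_generated :: "'a::cstar_algebra set \<Rightarrow> 'a set"
  where "cstar_generated X = \<Inter>{B. cstar_subalgebra B \<and> X \<subseteq> B}"

definition abelian_cstar_subalgebra :: "'a::cstar_algebra set \<Rightarrow> bool"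
  where "abelian_cstar_subalgebra B \<longleftrightarrow>
    cstar_subalgebra B \<and> (\<forall>x\<in>B. \<forall>y\<in>B. x * y = y * x)"

definition maximal_abelian_cstar_subalgebra :: "'a::cstar_algebra set \<Rightarrow> bool"
  where "maximal_abelian_cstar_subalgebra B \<longleftrightarrow>
    abelian_cstar_subalgebra B \<and>
    (\<forall>C. abelian_cstar_subalgebra C \<and> B \<subseteq> C \<longrightarrow> C = B)"

definition unital_star_hom :: "('a::cstar_algebra \<Rightarrow> 'b::cstar_algebra) \<Rightarrow> bool"
  where "unital_star_hom \<phi> \<longleftrightarrow>
    (\<forall>x y. \<phi> (x + y) = \<phi> x + \<phi> y) \<and>
    (\<forall>c x. \<phi> (c *\<^sub>C x) = c *\<^sub>C \<phi> x) \<and>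
    (\<forall>x y. \<phi> (x * y) = \<phi> x * \<phi> y) \<and>
    (\<forall>x. \<phi> (star x) = star (\<phi> x)) \<and>
    \<phi> 1 = 1"

definition two_adic_pair :: "'a::cstar_algebra \<Rightarrow> 'a \<Rightarrow> bool"
  where "two_adic_pair u s \<longleftrightarrow>
    star u * u = 1 \<and> u * star u = 1 \<and>
    star s * s = 1 \<and>
    s * u = u\<^sup>2 * s \<and>
    s * star s + u * s * star s * star u = 1"

lemma scaleC_simps [simp]:
  fixes x :: "'a::cstar_algebra"
  shows "1 *\<^sub>C x = x" "0 *\<^sub>C x = 0" "c *\<^sub>C (0::'a) = 0" "(- 1) *\<^sub>C x = - x"
proof -
  show "1 *\<^sub>C x = x" using scaleC_of_real[of 1 x] by simp
  show "0 *\<^sub>C x = 0" using scaleC_of_real[of 0 x] by simp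
  show "c *\<^sub>C (0::'a) = 0" using scaleC_add_right[of c "0::'a" 0] by simp
  show "(- 1) *\<^sub>C x = - x" using scaleC_of_real[of "-1" x] by simp
qed

lemma star_simps [simp]:
  fixes x y :: "'a::cstar_algebra"
  shows "star (0::'a) = 0" "star (1::'a) = 1" "star (- x) = - star x" "star (x - y) = star x - star y"
proof -
  show 0: "star (0::'a) = 0" using star_add[of "0::'a" 0] by simp
  show "star (1::'a) = 1" by (metis mult_1_left mult_1_right star_mult star_star)
  have m: "star (- z) = - star z" for z :: 'a
    using star_add[of z "- z"] 0 by (simp add: eq_neg_iff_add_eq_0 add.commute)
  show "star (- x) = - star x" by (rule m)
  show "star (x - y) = star x - star y"
    using star_add[of x "- y"] m by simp
qed

section \<open>The free unital *-algebra on two generators\<close>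

datatype letter = LU | LU_star | LS | LS_star

datatype word = Word (letters: "letter list")

instantiation word :: monoid_add
begin
definition "0 = Word []"
definition "v + w = Word (letters v @ letters w)"
instance by standard (auto simp: zero_word_def plus_word_def)
end

fun letter_star :: "letter \<Rightarrow> letter"
  where "letter_star LU = LU_star" | "letter_star LU_star = LU"
  | "letter_star LS = LS_star" | "letter_star LS_star = LS"

definition word_star :: "word \<Rightarrow> word"
  where "word_star w = Word (rev (map letter_star (letters w)))"

text \<open>Words are the basis; the product of \<open>Poly_Mapping\<close> is the convolution over the free monoid.\<close>

type_synonym free_alg = "word \<Rightarrow>\<^sub>0 complex"

lemma letter_star_star [simp]: "letter_star (letter_star l) = l"
  by (cases l) auto

lemma word_star_star [simp]: "word_star (word_star w) = w"
  by (cases w) (simp add: word_star_def rev_map comp_def)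

lemma word_star_add: "word_star (v + w) = word_star w + word_star v"
  by (simp add: word_star_def plus_word_def)

lemma word_star_zero [simp]: "word_star 0 = 0"
  by (simp add: word_star_def zero_word_def)

definition fscale :: "complex \<Rightarrow> free_alg \<Rightarrow> free_alg"
  where "fscale c f = Poly_Mapping.map ((*) c) f"

lift_definition fstar :: "free_alg \<Rightarrow> free_alg"
  is "\<lambda>f w. cnj (f (word_star w))"
proof -
  fix f :: "word \<Rightarrow> complex"
  assume "finite {k. f k \<noteq> 0}"
  then have "finite (word_star ` {k. f k \<noteq> 0})" by simp
  moreover have "{k. cnj (f (word_star k)) \<noteq> 0} \<subseteq> word_star ` {k. f k \<noteq> 0}"
    by (auto intro!: image_eqI[of _ word_star "word_star _"])
  ultimately show "finite {k. cnj (f (word_star k)) \<noteq> 0}" by (rule finite_subset[rotated])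
qed

definition gen :: "letter \<Rightarrow> free_alg"
  where "gen l = Poly_Mapping.single (Word [l]) 1"

definition relators :: "free_alg set"
  where "relators =
    {gen LU_star * gen LU - 1, gen LU * gen LU_star - 1,
     gen LS_star * gen LS - 1,
     gen LS * gen LU - (gen LU)\<^sup>2 * gen LS,
     gen LS * gen LS_star + gen LU * gen LS * gen LS_star * gen LU_star - 1}"

definition cstar_seminorm :: "(free_alg \<Rightarrow> real) \<Rightarrow> bool"
  where "cstar_seminorm q \<longleftrightarrow>
    (\<forall>f. 0 \<le> q f) \<and>
    (\<forall>f g. q (f + g) \<le> q f + q g) \<and>
    (\<forall>c f. q (fscale c f) = cmod c * q f) \<and>
    (\<forall>f g. q (f * g) \<le> q f * q g) \<and>
    (\<forall>f. q (fstar f * f) = (q f)\<^sup>2)"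

definition admissible :: "(free_alg \<Rightarrow> real) \<Rightarrow> bool"
  where "admissible q \<longleftrightarrow> cstar_seminorm q \<and> (\<forall>r\<in>relators. q r = 0)"

text \<open>The enveloping seminorm in the usual construction of a universal C*-algebra from generators and
  relations. The supremum is finite since every admissible seminorm is at most 1 on words.\<close>

definition universal_seminorm :: "free_alg \<Rightarrow> real"
  where "universal_seminorm f = (SUP q\<in>Collect admissible. q f)"

subsection \<open>Basic facts on the free *-algebra\<close>

lemma lookup_fscale [simp]: "Poly_Mapping.lookup (fscale c f) w = c * Poly_Mapping.lookup f w"
  by (simp add: fscale_def map.rep_eq when_def)

lemma lookup_fstar [simp]:
  "Poly_Mapping.lookup (fstar f) w = cnj (Poly_Mapping.lookup f (word_star w))"
  by (simp add: fstar.rep_eq)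

lemma fscale_conv_mult: "fscale c f = Poly_Mapping.single 0 c * f"
  by (simp add: fscale_def mult_map_scale_conv_mult)

lemma fscale_add_right: "fscale c (f + g) = fscale c f + fscale c g"
  by (rule poly_mapping_eqI) (simp add: lookup_add algebra_simps)

lemma fscale_diff_right: "fscale c (f - g) = fscale c f - fscale c g"
  by (rule poly_mapping_eqI) (simp add: lookup_minus algebra_simps)

lemma fscale_add_left: "fscale (c + d) f = fscale c f + fscale d f"
  by (rule poly_mapping_eqI) (simp add: lookup_add algebra_simps)

lemma fscale_fscale [simp]: "fscale c (fscale d f) = fscale (c * d) f"
  by (rule poly_mapping_eqI) simp

lemma fscale_one [simp]: "fscale 1 f = f"
  by (rule poly_mapping_eqI) simp

lemma fscale_zero [simp]: "fscale 0 f = 0"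
  by (rule poly_mapping_eqI) simp

lemma fscale_minus_one: "fscale (- 1) f = - f"
  by (rule poly_mapping_eqI) simp

lemma fstar_add: "fstar (f + g) = fstar f + fstar g"
  by (rule poly_mapping_eqI) (simp add: lookup_add)

lemma fstar_diff: "fstar (f - g) = fstar f - fstar g"
  by (rule poly_mapping_eqI) (simp add: lookup_minus)

lemma fstar_zero [simp]: "fstar 0 = 0"
  by (rule poly_mapping_eqI) simp

lemma fstar_fstar [simp]: "fstar (fstar f) = f"
  by (rule poly_mapping_eqI) simp

lemma fstar_fscale: "fstar (fscale c f) = fscale (cnj c) (fstar f)"
  by (rule poly_mapping_eqI) simp

lemma fstar_single: "fstar (Poly_Mapping.single w c) = Poly_Mapping.single (word_star w) (cnj c)"
  by (rule poly_mapping_eqI) (auto simp: lookup_single when_def)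

lemma fscale_single: "fscale c (Poly_Mapping.single w d) = Poly_Mapping.single w (c * d)"
  by (rule poly_mapping_eqI) (auto simp: lookup_single when_def)

lemma fscale_mult_left: "fscale c f * g = fscale c (f * g)"
  by (simp add: fscale_conv_mult mult.assoc)

lemma free_alg_expand:
  "f = (\<Sum>w\<in>Poly_Mapping.keys f. Poly_Mapping.single w (Poly_Mapping.lookup f w))"
proof (rule poly_mapping_eqI)
  fix k
  have "(\<Sum>w\<in>Poly_Mapping.keys f. Poly_Mapping.lookup (Poly_Mapping.single w (Poly_Mapping.lookup f w)) k)
      = (\<Sum>w\<in>Poly_Mapping.keys f. if w = k then Poly_Mapping.lookup f w else 0)"
    by (rule sum.cong) (auto simp: lookup_single when_def)
  also have "\<dots> = Poly_Mapping.lookup f k"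
    by (simp add: sum.delta in_keys_iff)
  finally show "Poly_Mapping.lookup f k = Poly_Mapping.lookup
      (\<Sum>w\<in>Poly_Mapping.keys f. Poly_Mapping.single w (Poly_Mapping.lookup f w)) k"
    by (simp add: lookup_sum)
qed

lemma free_alg_induct [case_names zero single add]:
  assumes "P 0" and "\<And>w c. P (Poly_Mapping.single w c)"
    and "\<And>f g. P f \<Longrightarrow> P g \<Longrightarrow> P (f + g)"
  shows "P (f :: free_alg)"
proof -
  have "P (\<Sum>w\<in>A. Poly_Mapping.single w (Poly_Mapping.lookup f w))" if "finite A" for A
    using that by (induction A) (auto intro: assms)
  then show ?thesis by (subst free_alg_expand) simp
qed

lemma fscale_mult_right: "f * fscale c g = fscale c (f * g)"
proof (induction f rule: free_alg_induct)
  case zero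
  show ?case by (rule poly_mapping_eqI) simp
next
  case (single w d)
  show ?case
    by (simp add: fscale_conv_mult mult_single mult.assoc[symmetric] mult.commute)
next
  case (add f h)
  then show ?case by (simp add: distrib_right fscale_add_right)
qed

lemma fstar_mult: "fstar (f * g) = fstar g * fstar f"
proof (induction f rule: free_alg_induct)
  case zero
  show ?case by simp
next
  case (single w c)
  show ?case
  proof (induction g rule: free_alg_induct)
    case zero
    show ?case by simp
  next
    case (single v d)
    show ?case by (simp add: mult_single fstar_single word_star_add mult.commute)
  next
    case (add g h)
    then show ?case by (simp add: distrib_left distrib_right fstar_add)
  qed
next
  case (add f h)
  then show ?case by (simp add: distrib_right distrib_left fstar_add)
qed

lemma fstar_one [simp]: "fstar 1 = 1"
  by (metis fstar_single single_one word_star_zero complex_cnj_one)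

lemma fstar_gen: "fstar (gen l) = gen (letter_star l)"
  by (simp add: gen_def fstar_single word_star_def)

subsection \<open>The universal seminorm is an admissible C*-seminorm\<close>

context
  fixes q assumes q: "cstar_seminorm q"
begin

lemma seminorm_nonneg: "0 \<le> q f"
  and seminorm_triangle: "q (f + g) \<le> q f + q g"
  and seminorm_scale: "q (fscale c f) = cmod c * q f"
  and seminorm_mult: "q (f * g) \<le> q f * q g"
  and seminorm_cstar: "q (fstar f * f) = (q f)\<^sup>2"
  using q unfolding cstar_seminorm_def by blast+

lemma seminorm_zero: "q 0 = 0"
  using seminorm_scale[of 0 0] by simp

lemma seminorm_minus: "q (- f) = q f"
  using seminorm_scale[of "- 1" f] by (simp add: fscale_minus_one)

lemma seminorm_minus_commute: "q (f - g) = q (g - f)"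
  using seminorm_minus[of "f - g"] by simp

lemma seminorm_triangle_diff: "q (f - h) \<le> q (f - g) + q (g - h)"
  using seminorm_triangle[of "f - g" "g - h"] by simp

lemma seminorm_diff_le: "\<bar>q f - q g\<bar> \<le> q (f - g)"
  using seminorm_triangle[of "f - g" g] seminorm_triangle[of "g - f" f]
    seminorm_minus_commute[of f g] by simp

lemma seminorm_fstar: "q (fstar f) = q f"
proof -
  have *: "q f \<le> q (fstar f)" for f
  proof (cases "q f = 0")
    case True
    then show ?thesis by (simp add: seminorm_nonneg)
  next
    case False
    then have "q f > 0" using seminorm_nonneg[of f] by simp
    moreover have "q f * q f \<le> q (fstar f) * q f"
      using seminorm_mult[of "fstar f" f] by (simp add: seminorm_cstar power2_eq_square)
    ultimately show ?thesis by simp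
  qed
  show ?thesis using *[of f] *[of "fstar f"] by simp
qed

lemma seminorm_one_le: "q 1 \<le> 1"
proof -
  have "q 1 = (q 1)\<^sup>2" using seminorm_cstar[of 1] by simp
  then have "q 1 = 0 \<or> q 1 = 1" by (simp add: power2_eq_square)
  then show ?thesis by auto
qed

lemma seminorm_eqI: "q (f - g) = 0 \<Longrightarrow> q f = q g"
  using seminorm_diff_le[of f g] by simp

lemma seminorm_sum: "q (sum F A) \<le> (\<Sum>a\<in>A. q (F a))"
proof (induction A rule: infinite_finite_induct)
  case (insert a A)
  then show ?case using seminorm_triangle[of "F a" "sum F A"] by simp
qed (simp_all add: seminorm_zero)

end

lemma admissible_word_le:
  assumes "admissible q"
  shows "q (Poly_Mapping.single w 1) \<le> 1"
proof -
  from assms have q: "cstar_seminorm q" and rel: "\<And>r. r \<in> relators \<Longrightarrow> q r = 0"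
    by (auto simp: admissible_def)
  note one = seminorm_one_le[OF q]
  have isom: "q (gen l) \<le> 1" if "q (gen (letter_star l) * gen l - 1) = 0" for l
  proof -
    have "(q (gen l))\<^sup>2 = q 1"
      using seminorm_eqI[OF q that] seminorm_cstar[OF q, of "gen l"] by (simp add: fstar_gen)
    then have "(q (gen l))\<^sup>2 \<le> 1\<^sup>2" using one by simp
    then show ?thesis by (rule power2_le_imp_le) simp
  qed
  have U: "q (gen LU) \<le> 1" and S: "q (gen LS) \<le> 1"
    by (rule isom, simp add: rel relators_def)+
  have letter: "q (gen l) \<le> 1" for l
    using U S seminorm_fstar[OF q, of "gen LU"] seminorm_fstar[OF q, of "gen LS"]
    by (cases l) (auto simp: fstar_gen)
  have "q (Poly_Mapping.single (Word ls) 1) \<le> 1" for ls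
  proof (induction ls)
    case Nil
    show ?case using one by (simp flip: zero_word_def)
  next
    case (Cons l ls)
    have "Poly_Mapping.single (Word (l # ls)) 1 = gen l * Poly_Mapping.single (Word ls) 1"
      by (simp add: gen_def mult_single plus_word_def)
    then have "q (Poly_Mapping.single (Word (l # ls)) 1) \<le> q (gen l) * q (Poly_Mapping.single (Word ls) 1)"
      using seminorm_mult[OF q] by simp
    also have "\<dots> \<le> 1 * 1"
      by (intro mult_mono letter Cons.IH seminorm_nonneg[OF q]) simp
    finally show ?case by simp
  qed
  then show ?thesis by (cases w) auto
qed

lemma admissible_le:
  assumes "admissible q"
  shows "q f \<le> (\<Sum>w\<in>Poly_Mapping.keys f. cmod (Poly_Mapping.lookup f w))"
proof -
  from assms have q: "cstar_seminorm q" by (auto simp: admissible_def)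
  have "q f = q (\<Sum>w\<in>Poly_Mapping.keys f. Poly_Mapping.single w (Poly_Mapping.lookup f w))"
    by (subst free_alg_expand) simp
  also have "\<dots> \<le> (\<Sum>w\<in>Poly_Mapping.keys f. q (Poly_Mapping.single w (Poly_Mapping.lookup f w)))"
    by (rule seminorm_sum[OF q])
  also have "\<dots> \<le> (\<Sum>w\<in>Poly_Mapping.keys f. cmod (Poly_Mapping.lookup f w))"
  proof (rule sum_mono)
    fix w
    have "q (Poly_Mapping.single w (Poly_Mapping.lookup f w))
        = cmod (Poly_Mapping.lookup f w) * q (Poly_Mapping.single w 1)"
      using seminorm_scale[OF q, of "Poly_Mapping.lookup f w" "Poly_Mapping.single w 1"]
      by (simp add: fscale_single)
    also have "\<dots> \<le> cmod (Poly_Mapping.lookup f w) * 1"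
      by (intro mult_left_mono admissible_word_le[OF assms]) simp
    finally show "q (Poly_Mapping.single w (Poly_Mapping.lookup f w)) \<le> cmod (Poly_Mapping.lookup f w)"
      by simp
  qed
  finally show ?thesis .
qed

lemma admissible_zero: "admissible (\<lambda>f. 0)"
  by (simp add: admissible_def cstar_seminorm_def)

lemma bdd_above_admissible: "bdd_above ((\<lambda>q. q f) ` Collect admissible)"
  using admissible_le[of _ f] by (intro bdd_aboveI2) auto

lemma admissible_le_universal: "admissible q \<Longrightarrow> q f \<le> universal_seminorm f"
  unfolding universal_seminorm_def by (rule cSUP_upper[OF _ bdd_above_admissible]) simp

lemma universal_seminorm_leI:
  "(\<And>q. admissible q \<Longrightarrow> q f \<le> B) \<Longrightarrow> universal_seminorm f \<le> B"
  unfolding universal_seminorm_def by (rule cSUP_least) (use admissible_zero in auto)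

lemma cstar_seminorm_universal: "cstar_seminorm universal_seminorm"
proof -
  let ?N = universal_seminorm
  have nn: "0 \<le> ?N f" for f
    using admissible_le_universal[OF admissible_zero] by simp
  have tri: "?N (f + g) \<le> ?N f + ?N g" for f g
  proof (rule universal_seminorm_leI)
    fix q assume a: "admissible q"
    then have "q (f + g) \<le> q f + q g" by (simp add: admissible_def cstar_seminorm_def)
    also have "\<dots> \<le> ?N f + ?N g" by (intro add_mono admissible_le_universal a)
    finally show "q (f + g) \<le> ?N f + ?N g" .
  qed
  have sc_le: "?N (fscale c f) \<le> cmod c * ?N f" for c f
  proof (rule universal_seminorm_leI)
    fix q assume a: "admissible q"
    then have "q (fscale c f) = cmod c * q f" by (simp add: admissible_def cstar_seminorm_def)
    also have "\<dots> \<le> cmod c * ?N f" by (intro mult_left_mono admissible_le_universal a) simp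
    finally show "q (fscale c f) \<le> cmod c * ?N f" .
  qed
  have sc: "?N (fscale c f) = cmod c * ?N f" for c f
  proof (cases "c = 0")
    case True
    then show ?thesis using sc_le[of 0 f] nn[of "fscale c f"] by simp
  next
    case False
    have "?N f \<le> cmod (inverse c) * ?N (fscale c f)"
      using sc_le[of "inverse c" "fscale c f"] False by simp
    then have "cmod c * ?N f \<le> ?N (fscale c f)"
      using False by (simp add: norm_divide field_simps)
    then show ?thesis using sc_le[of c f] by simp
  qed
  have mul: "?N (f * g) \<le> ?N f * ?N g" for f g
  proof (rule universal_seminorm_leI)
    fix q assume a: "admissible q"
    then have q: "cstar_seminorm q" by (simp add: admissible_def)
    have "q (f * g) \<le> q f * q g" by (rule seminorm_mult[OF q])
    also have "\<dots> \<le> ?N f * ?N g"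
      by (intro mult_mono admissible_le_universal a nn seminorm_nonneg[OF q])
    finally show "q (f * g) \<le> ?N f * ?N g" .
  qed
  have cs: "?N (fstar f * f) = (?N f)\<^sup>2" for f
  proof (rule antisym)
    show "?N (fstar f * f) \<le> (?N f)\<^sup>2"
    proof (rule universal_seminorm_leI)
      fix q assume a: "admissible q"
      then have q: "cstar_seminorm q" by (simp add: admissible_def)
      show "q (fstar f * f) \<le> (?N f)\<^sup>2"
        unfolding seminorm_cstar[OF q]
        by (intro power_mono admissible_le_universal a seminorm_nonneg[OF q])
    qed
    have "?N f \<le> sqrt (?N (fstar f * f))"
    proof (rule universal_seminorm_leI)
      fix q assume a: "admissible q"
      then have q: "cstar_seminorm q" by (simp add: admissible_def)
      have "(q f)\<^sup>2 \<le> ?N (fstar f * f)"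
        using admissible_le_universal[OF a, of "fstar f * f"] by (simp add: seminorm_cstar[OF q])
      then show "q f \<le> sqrt (?N (fstar f * f))" by (rule real_le_rsqrt)
    qed
    then have "(?N f)\<^sup>2 \<le> (sqrt (?N (fstar f * f)))\<^sup>2" by (intro power_mono nn)
    then show "(?N f)\<^sup>2 \<le> ?N (fstar f * f)" by (simp add: nn)
  qed
  show ?thesis unfolding cstar_seminorm_def using nn tri sc mul cs by blast
qed

lemma admissible_universal: "admissible universal_seminorm"
proof -
  have "universal_seminorm r = 0" if "r \<in> relators" for r
  proof (rule antisym)
    show "universal_seminorm r \<le> 0"
      by (rule universal_seminorm_leI) (use that in \<open>auto simp: admissible_def\<close>)
    show "0 \<le> universal_seminorm r"
      by (rule seminorm_nonneg[OF cstar_seminorm_universal])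
  qed
  then show ?thesis by (simp add: admissible_def cstar_seminorm_universal)
qed

section \<open>The 2-adic ring C*-algebra\<close>

definition Cauchy_seq :: "(nat \<Rightarrow> free_alg) \<Rightarrow> bool"
  where "Cauchy_seq X \<longleftrightarrow>
    (\<forall>e>0. \<exists>M. \<forall>m\<ge>M. \<forall>n\<ge>M. universal_seminorm (X m - X n) < e)"

definition Cauchy_rel :: "(nat \<Rightarrow> free_alg) \<Rightarrow> (nat \<Rightarrow> free_alg) \<Rightarrow> bool"
  where "Cauchy_rel X Y \<longleftrightarrow>
    Cauchy_seq X \<and> Cauchy_seq Y \<and> (\<lambda>n. universal_seminorm (X n - Y n)) \<longlonglongrightarrow> 0"

lemmas us_nonneg = seminorm_nonneg[OF cstar_seminorm_universal]
  and us_triangle = seminorm_triangle[OF cstar_seminorm_universal]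
  and us_scale = seminorm_scale[OF cstar_seminorm_universal]
  and us_mult = seminorm_mult[OF cstar_seminorm_universal]
  and us_cstar = seminorm_cstar[OF cstar_seminorm_universal]
  and us_zero = seminorm_zero[OF cstar_seminorm_universal]
  and us_minus = seminorm_minus[OF cstar_seminorm_universal]
  and us_minus_commute = seminorm_minus_commute[OF cstar_seminorm_universal]
  and us_triangle_diff = seminorm_triangle_diff[OF cstar_seminorm_universal]
  and us_diff_le = seminorm_diff_le[OF cstar_seminorm_universal]
  and us_fstar = seminorm_fstar[OF cstar_seminorm_universal]

lemma tendsto_zero_le:
  fixes f g :: "nat \<Rightarrow> real"
  assumes "g \<longlonglongrightarrow> 0" "\<And>n. 0 \<le> f n" "\<And>n. f n \<le> g n"
  shows "f \<longlonglongrightarrow> 0"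
  by (rule tendsto_sandwich[of "\<lambda>_. 0" f sequentially g]) (use assms in auto)

lemma Cauchy_rel_refl: "Cauchy_seq X \<Longrightarrow> Cauchy_rel X X"
  by (simp add: Cauchy_rel_def us_zero)

lemma Cauchy_rel_sym: "Cauchy_rel X Y \<Longrightarrow> Cauchy_rel Y X"
  by (simp add: Cauchy_rel_def us_minus_commute)

lemma Cauchy_rel_trans:
  assumes "Cauchy_rel X Y" "Cauchy_rel Y Z"
  shows "Cauchy_rel X Z"
proof -
  have "(\<lambda>n. universal_seminorm (X n - Y n) + universal_seminorm (Y n - Z n)) \<longlonglongrightarrow> 0"
    using tendsto_add[of "\<lambda>n. universal_seminorm (X n - Y n)" 0 _ "\<lambda>n. universal_seminorm (Y n - Z n)" 0] assms
    by (simp add: Cauchy_rel_def)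
  then have "(\<lambda>n. universal_seminorm (X n - Z n)) \<longlonglongrightarrow> 0"
    by (rule tendsto_zero_le) (simp_all add: us_nonneg us_triangle_diff)
  with assms show ?thesis by (simp add: Cauchy_rel_def)
qed

text \<open>The Hausdorff completion of the free *-algebra in the universal seminorm.\<close>

quotient_type two_adic_algebra = "nat \<Rightarrow> free_alg" / partial: Cauchy_rel
proof (rule part_equivpI)
  show "\<exists>X. Cauchy_rel X X"
    by (rule exI[of _ "\<lambda>_. 0"]) (simp add: Cauchy_rel_def Cauchy_seq_def us_zero)
  show "symp Cauchy_rel" by (rule sympI) (rule Cauchy_rel_sym)
  show "transp Cauchy_rel" by (rule transpI) (rule Cauchy_rel_trans)
qed

lemma Cauchy_seq_const: "Cauchy_seq (\<lambda>_. f)"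
  by (simp add: Cauchy_seq_def us_zero)

lemma Cauchy_seq_add:
  assumes "Cauchy_seq X" "Cauchy_seq Y"
  shows "Cauchy_seq (\<lambda>n. X n + Y n)"
  unfolding Cauchy_seq_def
proof (intro allI impI)
  fix e :: real assume "e > 0"
  then have "e / 2 > 0" by simp
  obtain M1 where M1: "\<And>m n. m \<ge> M1 \<Longrightarrow> n \<ge> M1 \<Longrightarrow> universal_seminorm (X m - X n) < e / 2"
    using assms(1) \<open>e / 2 > 0\<close> unfolding Cauchy_seq_def by blast
  obtain M2 where M2: "\<And>m n. m \<ge> M2 \<Longrightarrow> n \<ge> M2 \<Longrightarrow> universal_seminorm (Y m - Y n) < e / 2"
    using assms(2) \<open>e / 2 > 0\<close> unfolding Cauchy_seq_def by blast
  have "universal_seminorm (X m + Y m - (X n + Y n)) < e" if "m \<ge> max M1 M2" "n \<ge> max M1 M2" for m n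
  proof -
    have "universal_seminorm (X m + Y m - (X n + Y n)) \<le> universal_seminorm (X m - X n) + universal_seminorm (Y m - Y n)"
      using us_triangle[of "X m - X n" "Y m - Y n"] by (simp add: algebra_simps)
    then show ?thesis using M1[of m n] M2[of m n] that by simp
  qed
  then show "\<exists>M. \<forall>m\<ge>M. \<forall>n\<ge>M. universal_seminorm (X m + Y m - (X n + Y n)) < e" by blast
qed

lemma Cauchy_seq_bounded_image:
  assumes "Cauchy_seq X" and "K \<ge> 0"
    and "\<And>m n. universal_seminorm (F (X m) - F (X n)) \<le> K * universal_seminorm (X m - X n)"
  shows "Cauchy_seq (\<lambda>n. F (X n))"
  unfolding Cauchy_seq_def
proof (intro allI impI)
  fix e :: real assume "e > 0"
  then have "e / (K + 1) > 0" using assms(2) by simp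
  then obtain M where M: "\<And>m n. m \<ge> M \<Longrightarrow> n \<ge> M \<Longrightarrow> universal_seminorm (X m - X n) < e / (K + 1)"
    using assms(1) unfolding Cauchy_seq_def by blast
  have "universal_seminorm (F (X m) - F (X n)) < e" if "m \<ge> M" "n \<ge> M" for m n
  proof -
    have "universal_seminorm (F (X m) - F (X n)) \<le> (K + 1) * universal_seminorm (X m - X n)"
      using assms(3)[of m n] us_nonneg[of "X m - X n"] by (simp add: algebra_simps)
    also have "\<dots> < (K + 1) * (e / (K + 1))"
      using M[OF that] assms(2) by (intro mult_strict_left_mono) auto
    finally show ?thesis using assms(2) by simp
  qed
  then show "\<exists>M. \<forall>m\<ge>M. \<forall>n\<ge>M. universal_seminorm (F (X m) - F (X n)) < e" by blast
qed

lemma Cauchy_seq_uminus: "Cauchy_seq X \<Longrightarrow> Cauchy_seq (\<lambda>n. - X n)"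
  by (rule Cauchy_seq_bounded_image[where F = uminus and K = 1])
    (simp_all add: us_minus_commute)

lemma Cauchy_seq_fscale: "Cauchy_seq X \<Longrightarrow> Cauchy_seq (\<lambda>n. fscale c (X n))"
  by (rule Cauchy_seq_bounded_image[where F = "fscale c" and K = "cmod c"])
    (simp_all add: us_scale flip: fscale_diff_right)

lemma Cauchy_seq_fstar: "Cauchy_seq X \<Longrightarrow> Cauchy_seq (\<lambda>n. fstar (X n))"
  by (rule Cauchy_seq_bounded_image[where F = fstar and K = 1])
    (simp_all add: us_fstar flip: fstar_diff)

lemma Cauchy_seq_diff:
  "Cauchy_seq X \<Longrightarrow> Cauchy_seq Y \<Longrightarrow> Cauchy_seq (\<lambda>n. X n - Y n)"
  using Cauchy_seq_add[OF _ Cauchy_seq_uminus, of X Y] by simp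

lemma Cauchy_us:
  assumes "Cauchy_seq X"
  shows "Cauchy (\<lambda>n. universal_seminorm (X n))"
proof (rule metric_CauchyI)
  fix e :: real assume "e > 0"
  then obtain M where M: "\<And>m n. m \<ge> M \<Longrightarrow> n \<ge> M \<Longrightarrow> universal_seminorm (X m - X n) < e"
    using assms unfolding Cauchy_seq_def by blast
  have "dist (universal_seminorm (X m)) (universal_seminorm (X n)) < e" if "m \<ge> M" "n \<ge> M" for m n
    using M[OF that] us_diff_le[of "X m" "X n"] by (simp add: dist_real_def)
  then show "\<exists>M. \<forall>m\<ge>M. \<forall>n\<ge>M. dist (universal_seminorm (X m)) (universal_seminorm (X n)) < e" by blast
qed

lemma us_convergent: "Cauchy_seq X \<Longrightarrow> convergent (\<lambda>n. universal_seminorm (X n))"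
  using Cauchy_us real_Cauchy_convergent by blast

lemma Cauchy_seq_bounded:
  assumes "Cauchy_seq X"
  obtains K where "K > 0" "\<And>n. universal_seminorm (X n) \<le> K"
proof -
  have "Bseq (\<lambda>n. universal_seminorm (X n))" using Cauchy_us[OF assms] by (rule Cauchy_Bseq)
  then obtain K where "K > 0" "\<And>n. norm (universal_seminorm (X n)) \<le> K" unfolding Bseq_def by blast
  then show ?thesis by (intro that[of K]) (auto simp: us_nonneg)
qed

lemma us_mult_diff:
  assumes "universal_seminorm f \<le> K" "universal_seminorm g' \<le> L"
  shows "universal_seminorm (f * g - f' * g') \<le> K * universal_seminorm (g - g') + universal_seminorm (f - f') * L"
proof -
  have "universal_seminorm (f * g - f' * g') = universal_seminorm (f * (g - g') + (f - f') * g')"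
    by (simp add: algebra_simps)
  also have "\<dots> \<le> universal_seminorm (f * (g - g')) + universal_seminorm ((f - f') * g')" by (rule us_triangle)
  also have "\<dots> \<le> universal_seminorm f * universal_seminorm (g - g') + universal_seminorm (f - f') * universal_seminorm g'" by (intro add_mono us_mult)
  also have "\<dots> \<le> K * universal_seminorm (g - g') + universal_seminorm (f - f') * L"
    by (intro add_mono mult_left_mono mult_right_mono assms us_nonneg)
  finally show ?thesis .
qed

lemma Cauchy_seq_mult:
  assumes "Cauchy_seq X" "Cauchy_seq Y"
  shows "Cauchy_seq (\<lambda>n. X n * Y n)"
  unfolding Cauchy_seq_def
proof (intro allI impI)
  fix e :: real assume "e > 0"
  obtain K where K: "K > 0" "\<And>n. universal_seminorm (X n) \<le> K" using Cauchy_seq_bounded[OF assms(1)] by blast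
  obtain L where L: "L > 0" "\<And>n. universal_seminorm (Y n) \<le> L" using Cauchy_seq_bounded[OF assms(2)] by blast
  have "e / (2 * L) > 0" "e / (2 * K) > 0" using \<open>e > 0\<close> K L by auto
  obtain M1 where M1: "\<And>m n. m \<ge> M1 \<Longrightarrow> n \<ge> M1 \<Longrightarrow> universal_seminorm (X m - X n) < e / (2 * L)"
    using assms(1) \<open>e / (2 * L) > 0\<close> unfolding Cauchy_seq_def by blast
  obtain M2 where M2: "\<And>m n. m \<ge> M2 \<Longrightarrow> n \<ge> M2 \<Longrightarrow> universal_seminorm (Y m - Y n) < e / (2 * K)"
    using assms(2) \<open>e / (2 * K) > 0\<close> unfolding Cauchy_seq_def by blast
  have "universal_seminorm (X m * Y m - X n * Y n) < e" if "m \<ge> max M1 M2" "n \<ge> max M1 M2" for m n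
  proof -
    have "universal_seminorm (X m * Y m - X n * Y n) \<le> K * universal_seminorm (Y m - Y n) + universal_seminorm (X m - X n) * L"
      by (rule us_mult_diff[OF K(2) L(2)])
    also have "\<dots> < K * (e / (2 * K)) + e / (2 * L) * L"
      using M1[of m n] M2[of m n] that K L
      by (intro add_strict_mono mult_strict_left_mono mult_strict_right_mono) auto
    finally show ?thesis using K L by simp
  qed
  then show "\<exists>M. \<forall>m\<ge>M. \<forall>n\<ge>M. universal_seminorm (X m * Y m - X n * Y n) < e" by blast
qed

lemmas Cauchy_seq_intros = Cauchy_seq_const Cauchy_seq_add Cauchy_seq_uminus Cauchy_seq_fscale
  Cauchy_seq_fstar Cauchy_seq_diff Cauchy_seq_mult

lemma Cauchy_rel_add:
  assumes "Cauchy_rel X X'" "Cauchy_rel Y Y'"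
  shows "Cauchy_rel (\<lambda>n. X n + Y n) (\<lambda>n. X' n + Y' n)"
proof -
  have "(\<lambda>n. universal_seminorm (X n - X' n) + universal_seminorm (Y n - Y' n)) \<longlonglongrightarrow> 0"
    using tendsto_add[of "\<lambda>n. universal_seminorm (X n - X' n)" 0 _ "\<lambda>n. universal_seminorm (Y n - Y' n)" 0] assms
    by (simp add: Cauchy_rel_def)
  then have "(\<lambda>n. universal_seminorm (X n + Y n - (X' n + Y' n))) \<longlonglongrightarrow> 0"
  proof (rule tendsto_zero_le)
    fix n
    show "universal_seminorm (X n + Y n - (X' n + Y' n)) \<le> universal_seminorm (X n - X' n) + universal_seminorm (Y n - Y' n)"
      using us_triangle[of "X n - X' n" "Y n - Y' n"] by (simp add: algebra_simps)
  qed (simp add: us_nonneg)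
  with assms show ?thesis by (auto simp: Cauchy_rel_def intro!: Cauchy_seq_intros)
qed

lemma Cauchy_rel_uminus: "Cauchy_rel X Y \<Longrightarrow> Cauchy_rel (\<lambda>n. - X n) (\<lambda>n. - Y n)"
  by (auto simp: Cauchy_rel_def us_minus_commute intro!: Cauchy_seq_intros)

lemma Cauchy_rel_diff:
  "Cauchy_rel X X' \<Longrightarrow> Cauchy_rel Y Y' \<Longrightarrow> Cauchy_rel (\<lambda>n. X n - Y n) (\<lambda>n. X' n - Y' n)"
  using Cauchy_rel_add[OF _ Cauchy_rel_uminus, of X X' Y Y'] by simp

lemma Cauchy_rel_fscale: "Cauchy_rel X Y \<Longrightarrow> Cauchy_rel (\<lambda>n. fscale c (X n)) (\<lambda>n. fscale c (Y n))"
  using tendsto_mult_left_zero[of "\<lambda>n. universal_seminorm (X n - Y n)" sequentially "cmod c"]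
  by (auto simp: Cauchy_rel_def us_scale mult.commute simp flip: fscale_diff_right
      intro!: Cauchy_seq_intros)

lemma Cauchy_rel_fstar: "Cauchy_rel X Y \<Longrightarrow> Cauchy_rel (\<lambda>n. fstar (X n)) (\<lambda>n. fstar (Y n))"
  by (auto simp: Cauchy_rel_def us_fstar simp flip: fstar_diff intro!: Cauchy_seq_intros)

lemma Cauchy_rel_mult:
  assumes "Cauchy_rel X X'" "Cauchy_rel Y Y'"
  shows "Cauchy_rel (\<lambda>n. X n * Y n) (\<lambda>n. X' n * Y' n)"
proof -
  have C: "Cauchy_seq X" "Cauchy_seq Y'" using assms by (auto simp: Cauchy_rel_def)
  obtain K where K: "\<And>n. universal_seminorm (X n) \<le> K" using Cauchy_seq_bounded[OF C(1)] by blast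
  obtain L where L: "\<And>n. universal_seminorm (Y' n) \<le> L" using Cauchy_seq_bounded[OF C(2)] by blast
  have "(\<lambda>n. K * universal_seminorm (Y n - Y' n) + universal_seminorm (X n - X' n) * L) \<longlonglongrightarrow> K * 0 + 0 * L"
    using assms by (intro tendsto_intros) (auto simp: Cauchy_rel_def)
  then have "(\<lambda>n. K * universal_seminorm (Y n - Y' n) + universal_seminorm (X n - X' n) * L) \<longlonglongrightarrow> 0" by simp
  then have "(\<lambda>n. universal_seminorm (X n * Y n - X' n * Y' n)) \<longlonglongrightarrow> 0"
    by (rule tendsto_zero_le) (simp_all add: us_nonneg us_mult_diff[OF K L])
  with assms show ?thesis by (auto simp: Cauchy_rel_def intro!: Cauchy_seq_intros)
qed

lemma Cauchy_rel_lim: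
  assumes "Cauchy_rel X Y"
  shows "lim (\<lambda>n. universal_seminorm (X n)) = lim (\<lambda>n. universal_seminorm (Y n))"
proof -
  have "(\<lambda>n. universal_seminorm (X n) - universal_seminorm (Y n)) \<longlonglongrightarrow> 0"
    by (rule Lim_null_comparison[of _ "\<lambda>n. universal_seminorm (X n - Y n)"])
      (use assms in \<open>auto simp: Cauchy_rel_def us_diff_le\<close>)
  moreover have "(\<lambda>n. universal_seminorm (Y n)) \<longlonglongrightarrow> lim (\<lambda>n. universal_seminorm (Y n))"
    using assms us_convergent convergent_LIMSEQ_iff by (auto simp: Cauchy_rel_def)
  ultimately have "(\<lambda>n. universal_seminorm (X n) - universal_seminorm (Y n) + universal_seminorm (Y n)) \<longlonglongrightarrow> 0 + lim (\<lambda>n. universal_seminorm (Y n))"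
    by (rule tendsto_add)
  then show ?thesis by (simp add: limI)
qed

lift_definition two_adic_scale ::
  "complex \<Rightarrow> two_adic_algebra \<Rightarrow> two_adic_algebra" is "\<lambda>c X n. fscale c (X n)"
  by (rule Cauchy_rel_fscale)

lift_definition two_adic_star ::
  "two_adic_algebra \<Rightarrow> two_adic_algebra" is "\<lambda>X n. fstar (X n)"
  by (rule Cauchy_rel_fstar)

instantiation two_adic_algebra :: "{real_normed_algebra, monoid_mult}"
begin

lift_definition zero_two_adic_algebra :: two_adic_algebra is "\<lambda>n. 0"
  by (simp add: Cauchy_rel_refl Cauchy_seq_const)

lift_definition one_two_adic_algebra :: two_adic_algebra is "\<lambda>n. 1"
  by (simp add: Cauchy_rel_refl Cauchy_seq_const)

lift_definition plus_two_adic_algebra ::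
  "two_adic_algebra \<Rightarrow> two_adic_algebra \<Rightarrow> two_adic_algebra" is "\<lambda>X Y n. X n + Y n"
  by (rule Cauchy_rel_add)

lift_definition uminus_two_adic_algebra ::
  "two_adic_algebra \<Rightarrow> two_adic_algebra" is "\<lambda>X n. - X n"
  by (rule Cauchy_rel_uminus)

lift_definition minus_two_adic_algebra ::
  "two_adic_algebra \<Rightarrow> two_adic_algebra \<Rightarrow> two_adic_algebra" is "\<lambda>X Y n. X n - Y n"
  by (rule Cauchy_rel_diff)

lift_definition times_two_adic_algebra ::
  "two_adic_algebra \<Rightarrow> two_adic_algebra \<Rightarrow> two_adic_algebra" is "\<lambda>X Y n. X n * Y n"
  by (rule Cauchy_rel_mult)

lift_definition norm_two_adic_algebra ::
  "two_adic_algebra \<Rightarrow> real" is "\<lambda>X. lim (\<lambda>n. universal_seminorm (X n))"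
  by (rule Cauchy_rel_lim)

definition scaleR_two_adic_algebra :: "real \<Rightarrow> two_adic_algebra \<Rightarrow> two_adic_algebra"
  where "scaleR r (x::two_adic_algebra) = two_adic_scale (complex_of_real r) x"

definition sgn_two_adic_algebra :: "two_adic_algebra \<Rightarrow> two_adic_algebra"
  where "sgn (x::two_adic_algebra) = inverse (norm x) *\<^sub>R x"

definition dist_two_adic_algebra :: "two_adic_algebra \<Rightarrow> two_adic_algebra \<Rightarrow> real"
  where "dist (x::two_adic_algebra) y = norm (x - y)"

definition uniformity_two_adic_algebra :: "(two_adic_algebra \<times> two_adic_algebra) filter"
  where "uniformity = (INF e\<in>{0<..}. principal {(x, y :: two_adic_algebra). dist x y < e})"

definition open_two_adic_algebra :: "two_adic_algebra set \<Rightarrow> bool"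
  where "open (V :: two_adic_algebra set) \<longleftrightarrow> (\<forall>x\<in>V. \<forall>\<^sub>F (x', y) in uniformity. x' = x \<longrightarrow> y \<in> V)"

lemma rel_eqI: "Cauchy_seq X \<Longrightarrow> X = Y \<Longrightarrow> Cauchy_rel X Y"
  using Cauchy_rel_refl by simp

lemma rel_Cauchy: "Cauchy_rel X X \<Longrightarrow> Cauchy_seq X"
  by (simp add: Cauchy_rel_def)

lemma norm_tendsto:
  "Cauchy_seq X \<Longrightarrow> (\<lambda>n. universal_seminorm (X n)) \<longlonglongrightarrow> norm (abs_two_adic_algebra X)"
  using us_convergent[of X] Cauchy_rel_refl[of X]
  by (simp add: norm_two_adic_algebra.abs_eq convergent_LIMSEQ_iff)

lemma two_adic_cases:
  obtains X where "Cauchy_seq X" "x = abs_two_adic_algebra X"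
  by (metis Quotient3_abs_rep Quotient3_rep_reflp Quotient3_two_adic_algebra rel_Cauchy)

lemma abs_eqs2:
  assumes "Cauchy_seq X" "Cauchy_seq Y"
  shows "abs_two_adic_algebra X + abs_two_adic_algebra Y = abs_two_adic_algebra (\<lambda>n. X n + Y n)"
    and "abs_two_adic_algebra X - abs_two_adic_algebra Y = abs_two_adic_algebra (\<lambda>n. X n - Y n)"
    and "abs_two_adic_algebra X * abs_two_adic_algebra Y = abs_two_adic_algebra (\<lambda>n. X n * Y n)"
  using assms[THEN Cauchy_rel_refl]
  by (simp_all add: plus_two_adic_algebra.abs_eq minus_two_adic_algebra.abs_eq
      times_two_adic_algebra.abs_eq)

lemma abs_eqs1:
  assumes "Cauchy_seq X"
  shows "two_adic_scale c (abs_two_adic_algebra X) = abs_two_adic_algebra (\<lambda>n. fscale c (X n))"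
    and "two_adic_star (abs_two_adic_algebra X) = abs_two_adic_algebra (\<lambda>n. fstar (X n))"
  using assms[THEN Cauchy_rel_refl] by (simp_all add: two_adic_scale.abs_eq two_adic_star.abs_eq)

lemmas abs_eqs = abs_eqs1 abs_eqs2

definition emb :: "free_alg \<Rightarrow> two_adic_algebra"
  where "emb f = abs_two_adic_algebra (\<lambda>_. f)"

lemma norm_emb: "norm (emb f) = universal_seminorm f"
  unfolding emb_def
  using norm_tendsto[OF Cauchy_seq_const, of f] LIMSEQ_unique tendsto_const by blast

lemma emb_diff: "emb (f - g) = emb f - emb g"
  by (simp add: emb_def abs_eqs Cauchy_seq_const)

lemma norm_abs_minus_emb:
  assumes "Cauchy_seq X"
  shows "(\<lambda>n. universal_seminorm (X n - f)) \<longlonglongrightarrow> norm (abs_two_adic_algebra X - emb f)"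
  using norm_tendsto[OF Cauchy_seq_diff[OF assms Cauchy_seq_const, of f]] assms
  by (simp add: abs_eqs emb_def Cauchy_seq_const)

lemma emb_tendsto:
  assumes "Cauchy_seq X"
  shows "(\<lambda>k. norm (abs_two_adic_algebra X - emb (X k))) \<longlonglongrightarrow> 0"
proof (rule LIMSEQ_I)
  fix e :: real assume "e > 0"
  then have "e / 2 > 0" by simp
  then obtain M where M: "\<And>m n. m \<ge> M \<Longrightarrow> n \<ge> M \<Longrightarrow> universal_seminorm (X m - X n) < e / 2"
    using assms unfolding Cauchy_seq_def by blast
  have "norm (norm (abs_two_adic_algebra X - emb (X k)) - 0) < e" if "k \<ge> M" for k
  proof -
    have "norm (abs_two_adic_algebra X - emb (X k)) \<le> e / 2"
      by (rule LIMSEQ_le_const2[OF norm_abs_minus_emb[OF assms]])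
        (use M that in \<open>auto intro!: exI[of _ M] less_imp_le\<close>)
    moreover have "0 \<le> norm (abs_two_adic_algebra X - emb (X k))"
      by (rule LIMSEQ_le_const[OF norm_abs_minus_emb[OF assms]]) (auto simp: us_nonneg)
    ultimately show ?thesis using \<open>e > 0\<close> by simp
  qed
  then show "\<exists>M. \<forall>k\<ge>M. norm (norm (abs_two_adic_algebra X - emb (X k)) - 0) < e" by blast
qed

lemma two_adic_scaleC:
  fixes x y :: two_adic_algebra
  shows "two_adic_scale c (x + y) = two_adic_scale c x + two_adic_scale c y"
    and "two_adic_scale (c + d) x = two_adic_scale c x + two_adic_scale d x"
    and "two_adic_scale c (two_adic_scale d x) = two_adic_scale (c * d) x"
    and "two_adic_scale 1 x = x"
    and "two_adic_scale c x * y = two_adic_scale c (x * y)"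
    and "x * (two_adic_scale c y) = two_adic_scale c (x * y)"
  by (transfer, rule rel_eqI, auto intro!: Cauchy_seq_intros dest: rel_Cauchy
      simp: fscale_add_right fscale_add_left fscale_mult_left fscale_mult_right)+

lemma two_adic_star_props:
  fixes x y :: two_adic_algebra
  shows "two_adic_star (x + y) = two_adic_star x + two_adic_star y"
    and "two_adic_star (two_adic_scale c x) = two_adic_scale (cnj c) (two_adic_star x)"
    and "two_adic_star (x * y) = two_adic_star y * two_adic_star x"
    and "two_adic_star (two_adic_star x) = x"
  by (transfer, rule rel_eqI, auto intro!: Cauchy_seq_intros dest: rel_Cauchy
      simp: fstar_add fstar_mult fstar_fscale)+

lemma two_adic_norm_scaleC: "norm (two_adic_scale c x) = cmod c * norm (x :: two_adic_algebra)"
proof -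
  obtain X where X: "Cauchy_seq X" "x = abs_two_adic_algebra X" by (rule two_adic_cases)
  have "(\<lambda>n. universal_seminorm (fscale c (X n))) \<longlonglongrightarrow> norm (two_adic_scale c x)"
    using norm_tendsto[OF Cauchy_seq_fscale[OF X(1), of c]] X by (simp add: abs_eqs)
  moreover have "(\<lambda>n. universal_seminorm (fscale c (X n))) \<longlonglongrightarrow> cmod c * norm x"
    unfolding us_scale X(2) by (intro tendsto_intros norm_tendsto X)
  ultimately show ?thesis by (rule LIMSEQ_unique)
qed

lemma two_adic_norm_mult: "norm (x * y) \<le> norm x * norm (y :: two_adic_algebra)"
proof -
  obtain X where X: "Cauchy_seq X" "x = abs_two_adic_algebra X" by (rule two_adic_cases)
  obtain Y where Y: "Cauchy_seq Y" "y = abs_two_adic_algebra Y" by (rule two_adic_cases)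
  have "(\<lambda>n. universal_seminorm (X n * Y n)) \<longlonglongrightarrow> norm (x * y)"
    using norm_tendsto[OF Cauchy_seq_mult[OF X(1) Y(1)]] X Y by (simp add: abs_eqs)
  moreover have "(\<lambda>n. universal_seminorm (X n) * universal_seminorm (Y n)) \<longlonglongrightarrow> norm x * norm y"
    unfolding X(2) Y(2) by (intro tendsto_intros norm_tendsto X Y)
  ultimately show ?thesis by (rule LIMSEQ_le) (simp add: us_mult)
qed

lemma two_adic_norm_triangle: "norm (x + y) \<le> norm x + norm (y :: two_adic_algebra)"
proof -
  obtain X where X: "Cauchy_seq X" "x = abs_two_adic_algebra X" by (rule two_adic_cases)
  obtain Y where Y: "Cauchy_seq Y" "y = abs_two_adic_algebra Y" by (rule two_adic_cases)
  have "(\<lambda>n. universal_seminorm (X n + Y n)) \<longlonglongrightarrow> norm (x + y)"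
    using norm_tendsto[OF Cauchy_seq_add[OF X(1) Y(1)]] X Y by (simp add: abs_eqs)
  moreover have "(\<lambda>n. universal_seminorm (X n) + universal_seminorm (Y n)) \<longlonglongrightarrow> norm x + norm y"
    unfolding X(2) Y(2) by (intro tendsto_intros norm_tendsto X Y)
  ultimately show ?thesis by (rule LIMSEQ_le) (simp add: us_triangle)
qed

lemma two_adic_norm_cstar: "norm (two_adic_star x * x) = (norm (x :: two_adic_algebra))\<^sup>2"
proof -
  obtain X where X: "Cauchy_seq X" "x = abs_two_adic_algebra X" by (rule two_adic_cases)
  have "(\<lambda>n. universal_seminorm (fstar (X n) * X n)) \<longlonglongrightarrow> norm (two_adic_star x * x)"
    using norm_tendsto[OF Cauchy_seq_mult[OF Cauchy_seq_fstar X(1), of X]] X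
    by (simp add: abs_eqs Cauchy_seq_fstar)
  moreover have "(\<lambda>n. universal_seminorm (fstar (X n) * X n)) \<longlonglongrightarrow> (norm x)\<^sup>2"
    unfolding us_cstar X(2) by (intro tendsto_intros norm_tendsto X)
  ultimately show ?thesis by (rule LIMSEQ_unique)
qed

lemma two_adic_norm_zero_iff: "norm x = 0 \<longleftrightarrow> x = (0 :: two_adic_algebra)"
proof -
  obtain X where X: "Cauchy_seq X" "x = abs_two_adic_algebra X" by (rule two_adic_cases)
  have z: "0 = abs_two_adic_algebra (\<lambda>n. 0)" by (simp add: zero_two_adic_algebra_def)
  show ?thesis
  proof
    assume "norm x = 0"
    then have "(\<lambda>n. universal_seminorm (X n)) \<longlonglongrightarrow> 0" using norm_tendsto[OF X(1)] X by simp
    then have "Cauchy_rel X (\<lambda>n. 0)" using X by (simp add: Cauchy_rel_def Cauchy_seq_const)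
    then show "x = 0" unfolding X(2) z by (metis Quotient3_rel Quotient3_two_adic_algebra)
  next
    assume "x = 0"
    then show "norm x = 0" by (simp add: norm_two_adic_algebra.abs_eq z
          Cauchy_rel_refl Cauchy_seq_const us_zero limI)
  qed
qed

instance
proof
  fix x y z :: two_adic_algebra and a b :: real
  show "x + y + z = x + (y + z)"
    by transfer (rule rel_eqI, auto intro!: Cauchy_seq_intros dest: rel_Cauchy simp: ac_simps)
  show "x + y = y + x"
    by transfer (rule rel_eqI, auto intro!: Cauchy_seq_intros dest: rel_Cauchy simp: ac_simps)
  show "0 + x = x"
    by transfer (rule rel_eqI, auto intro!: Cauchy_seq_intros dest: rel_Cauchy)
  show "- x + x = 0"
    by transfer (rule rel_eqI, auto intro!: Cauchy_seq_intros dest: rel_Cauchy)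
  show "x - y = x + - y"
    by transfer (rule rel_eqI, auto intro!: Cauchy_seq_intros dest: rel_Cauchy)
  show "x * y * z = x * (y * z)"
    by transfer (rule rel_eqI, auto intro!: Cauchy_seq_intros dest: rel_Cauchy simp: mult.assoc)
  show "1 * x = x"
    by transfer (rule rel_eqI, auto intro!: Cauchy_seq_intros dest: rel_Cauchy)
  show "x * 1 = x"
    by transfer (rule rel_eqI, auto intro!: Cauchy_seq_intros dest: rel_Cauchy)
  show "(x + y) * z = x * z + y * z"
    by transfer (rule rel_eqI, auto intro!: Cauchy_seq_intros dest: rel_Cauchy simp: distrib_right)
  show "x * (y + z) = x * y + x * z"
    by transfer (rule rel_eqI, auto intro!: Cauchy_seq_intros dest: rel_Cauchy simp: distrib_left)
  show "norm (x * y) \<le> norm x * norm y" by (rule two_adic_norm_mult)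
  show "norm (x + y) \<le> norm x + norm y" by (rule two_adic_norm_triangle)
  show "(norm x = 0) = (x = 0)" by (rule two_adic_norm_zero_iff)
  show "a *\<^sub>R (x + y) = a *\<^sub>R x + a *\<^sub>R y" "(a + b) *\<^sub>R x = a *\<^sub>R x + b *\<^sub>R x"
    "a *\<^sub>R b *\<^sub>R x = (a * b) *\<^sub>R x" "1 *\<^sub>R x = x" "a *\<^sub>R x * y = a *\<^sub>R (x * y)"
    "x * a *\<^sub>R y = a *\<^sub>R (x * y)" "norm (a *\<^sub>R x) = \<bar>a\<bar> * norm x"
    by (simp_all add: scaleR_two_adic_algebra_def two_adic_scaleC two_adic_norm_scaleC)
  show "sgn x = inverse (norm x) *\<^sub>R x" by (rule sgn_two_adic_algebra_def)
  show "dist x y = norm (x - y)" by (rule dist_two_adic_algebra_def)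
  show "uniformity = (INF e\<in>{0<..}. principal {(x, y :: two_adic_algebra). dist x y < e})"
    by (rule uniformity_two_adic_algebra_def)
  show "open V \<longleftrightarrow> (\<forall>x\<in>V. \<forall>\<^sub>F (x', y) in uniformity. x' = x \<longrightarrow> y \<in> V)"
    for V :: "two_adic_algebra set"
    by (rule open_two_adic_algebra_def)
qed

end

instance two_adic_algebra :: banach
proof
  fix x :: "nat \<Rightarrow> two_adic_algebra"
  assume x: "Cauchy x"
  have "\<exists>f. norm (x k - emb f) < inverse (real (Suc k))" for k
  proof -
    obtain X where X: "Cauchy_seq X" "x k = abs_two_adic_algebra X" by (rule two_adic_cases)
    have "\<forall>\<^sub>F n in sequentially. norm (x k - emb (X n)) < inverse (real (Suc k))"
      using emb_tendsto[OF X(1)] X(2) by (intro order_tendstoD(2)[of _ 0]) auto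
    then show ?thesis by (meson eventually_happens sequentially_bot)
  qed
  then obtain f where f: "\<And>k. norm (x k - emb (f k)) < inverse (real (Suc k))" by metis
  have lim0: "(\<lambda>k. norm (x k - emb (f k))) \<longlonglongrightarrow> 0"
    by (rule tendsto_zero_le[OF LIMSEQ_inverse_real_of_nat]) (auto intro: less_imp_le[OF f] simp del: of_nat_Suc)
  have "Cauchy_seq f"
    unfolding Cauchy_seq_def
  proof (intro allI impI)
    fix e :: real assume "e > 0"
    then have e: "e / 3 > 0" by simp
    obtain M1 where M1: "\<And>m n. m \<ge> M1 \<Longrightarrow> n \<ge> M1 \<Longrightarrow> norm (x m - x n) < e / 3"
      using x e unfolding Cauchy_iff by blast
    obtain M2 where M2: "\<And>k. k \<ge> M2 \<Longrightarrow> norm (x k - emb (f k)) < e / 3"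
      using order_tendstoD(2)[OF lim0 e] unfolding eventually_sequentially by blast
    have "universal_seminorm (f m - f n) < e" if "m \<ge> max M1 M2" "n \<ge> max M1 M2" for m n
    proof -
      have "universal_seminorm (f m - f n) = norm ((x m - x n) - (x m - emb (f m)) + (x n - emb (f n)))"
        by (simp add: emb_diff flip: norm_emb)
      also have "\<dots> \<le> norm (x m - x n) + norm (x m - emb (f m)) + norm (x n - emb (f n))"
        by (meson add_right_mono norm_triangle_ineq norm_triangle_ineq4 order_trans)
      also have "\<dots> < e" using M1[of m n] M2[of m] M2[of n] that by simp
      finally show ?thesis .
    qed
    then show "\<exists>M. \<forall>m\<ge>M. \<forall>n\<ge>M. universal_seminorm (f m - f n) < e" by blast
  qed
  then have "(\<lambda>k. norm (abs_two_adic_algebra f - emb (f k))) \<longlonglongrightarrow> 0"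
    by (rule emb_tendsto)
  then have "(\<lambda>k. abs_two_adic_algebra f - emb (f k)) \<longlonglongrightarrow> 0"
    by (rule tendsto_norm_zero_cancel)
  moreover have "(\<lambda>k. x k - emb (f k)) \<longlonglongrightarrow> 0"
    using lim0 by (rule tendsto_norm_zero_cancel)
  ultimately have "(\<lambda>k. (x k - emb (f k)) - (abs_two_adic_algebra f - emb (f k))) \<longlonglongrightarrow> 0 - 0"
    by (rule tendsto_diff[rotated])
  then have "x \<longlonglongrightarrow> abs_two_adic_algebra f" by (simp add: LIM_zero_iff)
  then show "convergent x" by (rule convergentI)
qed

instantiation two_adic_algebra :: cstar_algebra
begin

definition scaleC_two_adic_algebra :: "complex \<Rightarrow> two_adic_algebra \<Rightarrow> two_adic_algebra"
  where "scaleC = two_adic_scale"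

definition star_two_adic_algebra :: "two_adic_algebra \<Rightarrow> two_adic_algebra"
  where "star = two_adic_star"

instance
  by standard (simp_all add: scaleC_two_adic_algebra_def star_two_adic_algebra_def
      two_adic_scaleC two_adic_star_props two_adic_norm_scaleC two_adic_norm_cstar
      scaleR_two_adic_algebra_def)

end

definition Q2_U :: two_adic_algebra where "Q2_U = emb (gen LU)"

definition Q2_S :: two_adic_algebra where "Q2_S = emb (gen LS)"

subsection \<open>The universal property\<close>

text \<open>\<open>two_adic_pair_Q2\<close>, \<open>Q2_generated\<close> and \<open>Q2_universal\<close> below show that the completion is the universal
  C*-algebra for the relations. The homomorphism in \<open>Q2_universal\<close> is unique because *-homomorphisms
  between C*-algebras are continuous and the two generators generate.\<close>

lemma emb_hom:
  "emb (f + g) = emb f + emb g" "emb (f * g) = emb f * emb g" "emb 1 = 1" "emb 0 = 0"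
  "emb (fscale c f) = c *\<^sub>C emb f" "emb (fstar f) = star (emb f)"
  by (simp_all add: emb_def abs_eqs Cauchy_seq_const scaleC_two_adic_algebra_def
      star_two_adic_algebra_def one_two_adic_algebra_def zero_two_adic_algebra_def)

lemma emb_power: "emb (f ^ n) = emb f ^ n"
  by (induction n) (simp_all add: emb_hom)

lemma emb_eqI:
  assumes "f - g \<in> relators"
  shows "emb f = emb g"
proof -
  have "universal_seminorm (f - g) = 0" using admissible_universal assms by (simp add: admissible_def)
  then have "norm (emb f - emb g) = 0" by (simp add: norm_emb flip: emb_diff)
  then show ?thesis by simp
qed

lemma star_gens: "star Q2_U = emb (gen LU_star)" "star Q2_S = emb (gen LS_star)"
  by (simp_all add: Q2_U_def Q2_S_def fstar_gen flip: emb_hom)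

theorem two_adic_pair_Q2: "two_adic_pair Q2_U Q2_S"
  unfolding two_adic_pair_def star_gens
  unfolding Q2_U_def Q2_S_def emb_hom(2)[symmetric] emb_power[symmetric] emb_hom(1)[symmetric]
    emb_hom(3)[symmetric]
  by (intro conjI emb_eqI) (simp_all add: relators_def)

lemma cstar_subalgebra_sum:
  "cstar_subalgebra B \<Longrightarrow> (\<And>i. i \<in> I \<Longrightarrow> g i \<in> B) \<Longrightarrow> sum g I \<in> B"
  by (induction I rule: infinite_finite_induct) (auto simp: cstar_subalgebra_def)

theorem Q2_generated: "cstar_generated {Q2_U, Q2_S} = UNIV"
proof -
  have "x \<in> B" if B: "cstar_subalgebra B" "Q2_U \<in> B" "Q2_S \<in> B" for B x
  proof -
    have c: "0 \<in> B" "\<And>x y. x \<in> B \<Longrightarrow> y \<in> B \<Longrightarrow> x + y \<in> B"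
      "\<And>x y. x \<in> B \<Longrightarrow> y \<in> B \<Longrightarrow> x * y \<in> B" "\<And>c x. x \<in> B \<Longrightarrow> c *\<^sub>C x \<in> B"
      "\<And>x. x \<in> B \<Longrightarrow> star x \<in> B" "closed B"
      using B(1) unfolding cstar_subalgebra_def by blast+
    have letter: "emb (gen l) \<in> B" for l
      using B(2,3)[unfolded Q2_U_def Q2_S_def] c(5)[OF B(2), unfolded star_gens(1)]
        c(5)[OF B(3), unfolded star_gens(2)]
      by (cases l) simp_all
    have one: "1 \<in> B"
      using two_adic_pair_Q2 c(3)[OF c(5)[OF B(2)] B(2)] unfolding two_adic_pair_def by simp
    have word: "emb (Poly_Mapping.single (Word ls) 1) \<in> B" for ls
    proof (induction ls)
      case Nil
      show ?case using one by (simp add: emb_hom flip: zero_word_def)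
    next
      case (Cons l ls)
      have "Poly_Mapping.single (Word (l # ls)) 1 = gen l * Poly_Mapping.single (Word ls) 1"
        by (simp add: gen_def mult_single plus_word_def)
      then show ?case using c(3)[OF letter[of l] Cons.IH] by (simp add: emb_hom)
    qed
    have emb: "emb f \<in> B" for f
    proof (induction f rule: free_alg_induct)
      case zero
      show ?case using c(1) by (simp add: emb_hom)
    next
      case (single w d)
      have "Poly_Mapping.single w d = fscale d (Poly_Mapping.single (Word (letters w)) 1)"
        by (simp add: fscale_single)
      then show ?case using c(4)[OF word[of "letters w"]] by (simp add: emb_hom)
    next
      case (add f g)
      then show ?case using c(2) by (simp add: emb_hom)
    qed
    obtain X where X: "Cauchy_seq X" "x = abs_two_adic_algebra X" by (rule two_adic_cases)
    have "(\<lambda>k. x - emb (X k)) \<longlonglongrightarrow> 0"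
      using emb_tendsto[OF X(1)] X(2) by (simp add: tendsto_norm_zero_iff)
    then have "(\<lambda>k. x - (x - emb (X k))) \<longlonglongrightarrow> x - 0" by (intro tendsto_diff tendsto_const)
    then have "(\<lambda>k. emb (X k)) \<longlonglongrightarrow> x" by simp
    then show ?thesis by (rule closed_sequentially[OF c(6) emb])
  qed
  then show ?thesis unfolding cstar_generated_def by blast
qed

fun letter_val :: "'a::cstar_algebra \<Rightarrow> 'a \<Rightarrow> letter \<Rightarrow> 'a"
  where "letter_val u s LU = u" | "letter_val u s LU_star = star u"
  | "letter_val u s LS = s" | "letter_val u s LS_star = star s"

definition word_val :: "'a::cstar_algebra \<Rightarrow> 'a \<Rightarrow> word \<Rightarrow> 'a"
  where "word_val u s w = prod_list (map (letter_val u s) (letters w))"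

definition poly_val :: "'a::cstar_algebra \<Rightarrow> 'a \<Rightarrow> free_alg \<Rightarrow> 'a"
  where "poly_val u s f =
    (\<Sum>w\<in>Poly_Mapping.keys f. Poly_Mapping.lookup f w *\<^sub>C word_val u s w)"

lemma poly_val_superset:
  assumes "finite A" "Poly_Mapping.keys f \<subseteq> A"
  shows "poly_val u s f = (\<Sum>w\<in>A. Poly_Mapping.lookup f w *\<^sub>C word_val u s w)"
  unfolding poly_val_def
  by (rule sum.mono_neutral_left) (use assms in \<open>auto simp: in_keys_iff\<close>)

lemma poly_val_single: "poly_val u s (Poly_Mapping.single w c) = c *\<^sub>C word_val u s w"
  by (subst poly_val_superset[of "{w}"]) auto

lemma poly_val_zero [simp]: "poly_val u s 0 = 0"
  by (simp add: poly_val_def)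

lemma poly_val_add: "poly_val u s (f + g) = poly_val u s f + poly_val u s g"
proof -
  let ?A = "Poly_Mapping.keys f \<union> Poly_Mapping.keys g"
  have "poly_val u s (f + g) = (\<Sum>w\<in>?A. Poly_Mapping.lookup (f + g) w *\<^sub>C word_val u s w)"
    by (rule poly_val_superset) (auto simp: keys_add)
  moreover have "poly_val u s f = (\<Sum>w\<in>?A. Poly_Mapping.lookup f w *\<^sub>C word_val u s w)"
    by (rule poly_val_superset) auto
  moreover have "poly_val u s g = (\<Sum>w\<in>?A. Poly_Mapping.lookup g w *\<^sub>C word_val u s w)"
    by (rule poly_val_superset) auto
  ultimately show ?thesis by (simp add: lookup_add scaleC_add_left sum.distrib)
qed

lemma word_val_add: "word_val u s (v + w) = word_val u s v * word_val u s w"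
  by (simp add: word_val_def plus_word_def)

lemma word_val_star: "word_val u s (word_star w) = star (word_val u s w)"
proof -
  have l: "letter_val u s (letter_star l) = star (letter_val u s l)" for l
    by (cases l) (simp_all add: star_star)
  have "prod_list (map (letter_val u s) (rev (map letter_star ls))) =
      star (prod_list (map (letter_val u s) ls))" for ls
    by (induction ls) (simp_all add: l star_mult)
  then show ?thesis by (simp add: word_val_def word_star_def)
qed

lemma poly_val_fscale: "poly_val u s (fscale c f) = c *\<^sub>C poly_val u s f"
  by (induction f rule: free_alg_induct)
    (simp_all add: fscale_add_right poly_val_add scaleC_add_right fscale_single poly_val_single
      scaleC_scaleC fscale_conv_mult[of c 0])

lemma poly_val_fstar: "poly_val u s (fstar f) = star (poly_val u s f)"
  by (induction f rule: free_alg_induct)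
    (simp_all add: fstar_add poly_val_add star_add fstar_single poly_val_single
      star_scaleC word_val_star)

lemma poly_val_mult: "poly_val u s (f * g) = poly_val u s f * poly_val u s g"
proof (induction f rule: free_alg_induct)
  case (single v c)
  show ?case
    by (induction g rule: free_alg_induct)
      (simp_all add: distrib_left poly_val_add mult_single poly_val_single word_val_add
        mult_scaleC_left mult_scaleC_right scaleC_scaleC mult.commute)
qed (simp_all add: distrib_right poly_val_add)

lemma poly_val_one: "poly_val u s 1 = 1"
  using poly_val_single[of u s 0 1] by (simp add: word_val_def zero_word_def flip: single_one)

lemma poly_val_gen: "poly_val u s (gen l) = letter_val u s l"
  by (simp add: gen_def poly_val_single word_val_def)

lemma poly_val_diff: "poly_val u s (f - g) = poly_val u s f - poly_val u s g"
  using poly_val_add[of u s "f - g" g] by simp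

lemma norm_poly_val_le:
  assumes "two_adic_pair u s"
  shows "norm (poly_val u s f) \<le> universal_seminorm f"
proof -
  have "cstar_seminorm (\<lambda>f. norm (poly_val u s f))"
    unfolding cstar_seminorm_def
    by (auto simp: poly_val_add poly_val_fscale poly_val_mult poly_val_fstar norm_scaleC
        norm_triangle_ineq norm_mult_ineq cstar_identity)
  moreover have "poly_val u s r = 0" if "r \<in> relators" for r
    using that assms unfolding relators_def two_adic_pair_def
    by (auto simp: poly_val_diff poly_val_add poly_val_mult poly_val_one poly_val_gen
        power2_eq_square)
  ultimately show ?thesis
    using admissible_le_universal[of "\<lambda>f. norm (poly_val u s f)" f] by (simp add: admissible_def)
qed

lemma poly_val_Cauchy:
  assumes "two_adic_pair u s" "Cauchy_seq X"
  shows "convergent (\<lambda>n. poly_val u s (X n))"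
proof -
  have "Cauchy (\<lambda>n. poly_val u s (X n))"
    unfolding Cauchy_iff
  proof (intro allI impI)
    fix e :: real assume "e > 0"
    then obtain M where M: "\<And>m n. m \<ge> M \<Longrightarrow> n \<ge> M \<Longrightarrow> universal_seminorm (X m - X n) < e"
      using assms(2) unfolding Cauchy_seq_def by blast
    have "norm (poly_val u s (X m) - poly_val u s (X n)) < e" if "m \<ge> M" "n \<ge> M" for m n
      using M[OF that] norm_poly_val_le[OF assms(1), of "X m - X n"] by (simp add: poly_val_diff)
    then show "\<exists>M. \<forall>m\<ge>M. \<forall>n\<ge>M. norm (poly_val u s (X m) - poly_val u s (X n)) < e" by blast
  qed
  then show ?thesis by (rule Cauchy_convergent)
qed

theorem Q2_universal:
  fixes u s :: "'b::cstar_algebra"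
  assumes us: "two_adic_pair u s"
  shows "\<exists>\<phi> :: two_adic_algebra \<Rightarrow> 'b. unital_star_hom \<phi> \<and> \<phi> Q2_U = u \<and> \<phi> Q2_S = s"
proof -
  define \<phi> where "\<phi> x = lim (\<lambda>n. poly_val u s (rep_two_adic_algebra x n))" for x
  have lim: "(\<lambda>n. poly_val u s (X n)) \<longlonglongrightarrow> \<phi> (abs_two_adic_algebra X)" if X: "Cauchy_seq X" for X
  proof -
    let ?Y = "rep_two_adic_algebra (abs_two_adic_algebra X)"
    have rel: "Cauchy_rel ?Y X"
      by (rule rep_abs_rsp_left[OF Quotient3_two_adic_algebra]) (rule Cauchy_rel_refl[OF X])
    then have Y: "Cauchy_seq ?Y" by (simp add: Cauchy_rel_def)
    have "(\<lambda>n. poly_val u s (?Y n)) \<longlonglongrightarrow> \<phi> (abs_two_adic_algebra X)"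
      unfolding \<phi>_def using poly_val_Cauchy[OF us Y] by (simp add: convergent_LIMSEQ_iff)
    moreover have "(\<lambda>n. poly_val u s (?Y n) - poly_val u s (X n)) \<longlonglongrightarrow> 0"
      by (rule Lim_null_comparison[of _ "\<lambda>n. universal_seminorm (?Y n - X n)"])
        (use rel norm_poly_val_le[OF us] in \<open>auto simp: Cauchy_rel_def simp flip: poly_val_diff\<close>)
    ultimately have "(\<lambda>n. poly_val u s (?Y n) - (poly_val u s (?Y n) - poly_val u s (X n)))
        \<longlonglongrightarrow> \<phi> (abs_two_adic_algebra X) - 0"
      by (rule tendsto_diff)
    then show ?thesis by simp
  qed
  have emb: "\<phi> (emb f) = poly_val u s f" for f
    using lim[OF Cauchy_seq_const, of f] LIMSEQ_unique tendsto_const unfolding emb_def by blast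
  have sc: "bounded_linear (\<lambda>x :: 'b. c *\<^sub>C x)" for c
    by (rule bounded_linear_intro[where K = "cmod c"])
      (simp_all add: scaleC_add_right norm_scaleC scaleC_scaleC mult.commute flip: scaleC_of_real)
  have st: "bounded_linear (star :: 'b \<Rightarrow> 'b)"
  proof (rule bounded_linear_intro[where K = 1])
    fix x :: 'b
    show "norm (star x) \<le> norm x * 1"
    proof (cases "norm (star x) = 0")
      case False
      have "norm (star x) * norm (star x) = norm (star (star x) * star x)"
        by (simp only: cstar_identity power2_eq_square)
      also have "\<dots> \<le> norm x * norm (star x)" unfolding star_star by (rule norm_mult_ineq)
      finally show ?thesis using False by simp
    qed simp
  qed (simp_all add: star_add star_scaleC flip: scaleC_of_real)
  have "unital_star_hom \<phi>"
    unfolding unital_star_hom_def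
  proof (intro conjI allI)
    fix x y :: two_adic_algebra and c :: complex
    obtain X where X: "Cauchy_seq X" "x = abs_two_adic_algebra X" by (rule two_adic_cases)
    obtain Y where Y: "Cauchy_seq Y" "y = abs_two_adic_algebra Y" by (rule two_adic_cases)
    note LX = lim[OF X(1), folded X(2)] and LY = lim[OF Y(1), folded Y(2)]
    show "\<phi> (x + y) = \<phi> x + \<phi> y"
      using lim[OF Cauchy_seq_add[OF X(1) Y(1)]] tendsto_add[OF LX LY]
      by (intro LIMSEQ_unique[of "\<lambda>n. poly_val u s (X n + Y n)"])
        (simp_all add: X Y abs_eqs poly_val_add)
    show "\<phi> (x * y) = \<phi> x * \<phi> y"
      using lim[OF Cauchy_seq_mult[OF X(1) Y(1)]] tendsto_mult[OF LX LY]
      by (intro LIMSEQ_unique[of "\<lambda>n. poly_val u s (X n * Y n)"])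
        (simp_all add: X Y abs_eqs poly_val_mult)
    show "\<phi> (c *\<^sub>C x) = c *\<^sub>C \<phi> x"
      using lim[OF Cauchy_seq_fscale[OF X(1)], of c] bounded_linear.tendsto[OF sc LX, of c]
      by (intro LIMSEQ_unique[of "\<lambda>n. poly_val u s (fscale c (X n))"])
        (simp_all add: X abs_eqs poly_val_fscale scaleC_two_adic_algebra_def)
    show "\<phi> (star x) = star (\<phi> x)"
      using lim[OF Cauchy_seq_fstar[OF X(1)]] bounded_linear.tendsto[OF st LX]
      by (intro LIMSEQ_unique[of "\<lambda>n. poly_val u s (fstar (X n))"])
        (simp_all add: X abs_eqs poly_val_fstar star_two_adic_algebra_def)
  next
    show "\<phi> 1 = 1" using emb[of 1] by (simp add: emb_hom poly_val_one)
  qed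
  moreover have "\<phi> Q2_U = u" "\<phi> Q2_S = s"
    by (simp_all add: Q2_U_def Q2_S_def emb poly_val_gen)
  ultimately show ?thesis by blast
qed

end

theory Submission
  imports Defs
begin

text \<open>Write \<open>U\<close> and \<open>S\<close> for the generators. An abelian subalgebra that contains \<open>U\<close> consists of elements
  commuting with \<open>U\<close>, so it suffices that every \<open>x\<close> with \<open>x * U = U * x\<close> is a norm limit of trigonometric
  polynomials in \<open>U\<close> (\<open>commuting_in_closure_trig\<close>).

  The relations are homogeneous if \<open>S\<close> has degree \<open>1\<close> and \<open>U\<close> has degree \<open>0\<close>. The algebra is universal, so the
  circle acts on it by the gauge automorphisms \<open>S \<mapsto> \<lambda>S\<close>, \<open>U \<mapsto> U\<close>. Averaging over this action gives contractive
  projections onto the components of each degree, and these components commute with \<open>U\<close> if \<open>x\<close> does. Fejer means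
  along the degree recover \<open>x\<close> from its components. The question thus reduces to homogeneous elements.

  In degree \<open>0\<close>, averaging over conjugation by \<open>U\<^sup>r\<close> with \<open>r < 2\<^sup>l\<close> fixes \<open>x\<close>, and maps any polynomial of degree
  \<open>0\<close> to a trigonometric polynomial if \<open>l\<close> is large, because the conjugates of the range projection of \<open>S\<^sup>l\<close>
  add up to \<open>1\<close> (\<open>commuting_degree_0\<close>).

  In degree \<open>n \<noteq> 0\<close> the component vanishes (\<open>commuting_nonzero_degree\<close>). On the circle, with \<open>U\<close> as the coordinate,
  a polynomial of degree \<open>n > 0\<close> relates a point \<open>z\<close> to the products of \<open>z ^ 2 ^ n\<close> with finitely many roots of
  unity. Commuting with \<open>U\<close> leaves only those \<open>z\<close> that are related to themselves; they are finite in number,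
  which is too few to carry anything continuous. Algebraically, such an
  \<open>x\<close> is almost invariant under multiplication by arbitrarily large powers of \<open>U\<close>. The same then holds for
  \<open>x * star x\<close>, which has degree \<open>0\<close> and is therefore a limit of trigonometric polynomials. A trigonometric
  polynomial with this property is small (\<open>trig_norm_le_of_shifts\<close>): its Fejer means, which are compressions
  \<open>a \<mapsto> Y * a * star Y / K\<close> by suitable elements \<open>Y\<close> of the algebra, ignore large frequencies. This step
  stands in for the faithfulness of the representation on the circle.\<close>

section \<open>Commutants and generated subalgebras\<close>

lemma norm_star: "norm (star x) = norm (x::'a::cstar_algebra)"
proof -
  have le: "norm y \<le> norm (star y)" for y :: 'a
  proof (cases "norm y = 0")
    case False
    have "norm y * norm y = norm (star y * y)"
      by (simp add: cstar_identity power2_eq_square)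
    also have "\<dots> \<le> norm (star y) * norm y" by (rule norm_mult_ineq)
    finally show ?thesis using False by simp
  qed simp
  show ?thesis using le[of x] le[of "star x"] by (simp add: star_star)
qed

lemma norm_one_le: "norm (1::'a::cstar_algebra) \<le> 1"
proof -
  have "norm (1::'a) = (norm (1::'a))\<^sup>2" using cstar_identity[of "1::'a"] by simp
  then have "norm (1::'a) = 0 \<or> norm (1::'a) = 1" by (simp add: power2_eq_square)
  then show ?thesis by auto
qed

lemma star_power: "star (x ^ n) = star (x::'a::cstar_algebra) ^ n"
  by (induction n) (simp_all add: star_mult power_commutes)

lemma star_sum: "star (sum g I) = (\<Sum>i\<in>I. star (g i :: 'a::cstar_algebra))"
  by (induction I rule: infinite_finite_induct) (simp_all add: star_add)

lemma scaleC_sum_right: "c *\<^sub>C sum g I = (\<Sum>i\<in>I. c *\<^sub>C (g i :: 'a::cstar_algebra))"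
  by (induction I rule: infinite_finite_induct) (simp_all add: scaleC_add_right)

lemma bounded_linear_scaleC: "bounded_linear (scaleC c :: 'a::cstar_algebra \<Rightarrow> 'a)"
  by (rule bounded_linear_intro[where K = "cmod c"])
    (simp_all add: scaleC_add_right norm_scaleC scaleC_scaleC mult.commute flip: scaleC_of_real)

lemma bounded_linear_star: "bounded_linear (star :: 'a::cstar_algebra \<Rightarrow> 'a)"
  by (rule bounded_linear_intro[where K = 1])
    (simp_all add: star_add star_scaleC norm_star flip: scaleC_of_real)

definition commutant :: "'a::cstar_algebra set \<Rightarrow> 'a set"
  where "commutant Y = {x. \<forall>y\<in>Y. x * y = y * x}"

lemma cstar_subalgebra_commutant:
  fixes Y :: "'a::cstar_algebra set"
  assumes "\<And>y. y \<in> Y \<Longrightarrow> star y \<in> Y"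
  shows "cstar_subalgebra (commutant Y)"
proof -
  have "star x * y = y * star x" if x: "x \<in> commutant Y" and y: "y \<in> Y" for x y
  proof -
    have "star (star y * x) = star (x * star y)" using x assms[OF y] by (simp add: commutant_def)
    then show ?thesis by (simp add: star_mult star_star)
  qed
  moreover have "closed (commutant Y)"
  proof -
    have "commutant Y = (\<Inter>y\<in>Y. {x. x * y = y * x})" by (auto simp: commutant_def)
    moreover have "closed {x. x * y = y * x}" for y :: 'a
      by (intro closed_Collect_eq continuous_intros)
    ultimately show ?thesis by auto
  qed
  moreover have "x * y * z = z * (x * y)" if "x * z = z * x" "y * z = z * y" for x y z :: 'a
    using that by (metis mult.assoc)
  ultimately show ?thesis
    unfolding cstar_subalgebra_def
    by (auto simp: commutant_def distrib_left distrib_right mult_scaleC_left mult_scaleC_right)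
qed

lemma cstar_generated_least: "cstar_subalgebra B \<Longrightarrow> X \<subseteq> B \<Longrightarrow> cstar_generated X \<subseteq> B"
  by (auto simp: cstar_generated_def)

lemma cstar_generated_superset: "X \<subseteq> cstar_generated X"
  by (auto simp: cstar_generated_def)

lemma cstar_subalgebra_generated: "cstar_subalgebra (cstar_generated X)"
proof -
  have "closed (cstar_generated X)"
    unfolding cstar_generated_def by (rule closed_Inter) (auto simp: cstar_subalgebra_def)
  then show ?thesis
    unfolding cstar_subalgebra_def by (auto simp: cstar_generated_def cstar_subalgebra_def)
qed

text \<open>Commutants of self-adjoint sets are C*-subalgebras, so commutation with the generators spreads to
  the generated subalgebra, first in one argument and then in the other.\<close>

lemma abelian_cstar_generated:
  assumes "star u * u = u * star u"
  shows "abelian_cstar_subalgebra (cstar_generated {u})"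
proof -
  let ?A = "cstar_generated {u}"
  have sub: "cstar_subalgebra ?A" by (rule cstar_subalgebra_generated)
  then have star: "star x \<in> ?A" if "x \<in> ?A" for x
    using that by (simp add: cstar_subalgebra_def)
  have "?A \<subseteq> commutant {u, star u}"
    by (intro cstar_generated_least cstar_subalgebra_commutant)
      (use assms in \<open>auto simp: commutant_def star_star\<close>)
  then have "?A \<subseteq> commutant ?A"
    by (intro cstar_generated_least cstar_subalgebra_commutant star) (auto simp: commutant_def)
  then show ?thesis using sub by (auto simp: abelian_cstar_subalgebra_def commutant_def)
qed

section \<open>Integer powers and the isometries\<close>

lemma sum_lessThan_double:
  fixes g :: "nat \<Rightarrow> 'b::comm_monoid_add"
  shows "(\<Sum>r<2 * n. g r) = (\<Sum>r<n. g r + g (n + r))"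
proof -
  have "(\<Sum>r<n + k. g r) = (\<Sum>r<n. g r) + (\<Sum>r<k. g (n + r))" for k
    by (induction k) (simp_all add: add.assoc)
  from this[of n] show ?thesis by (simp add: sum.distrib mult_2)
qed

locale two_adic =
  fixes u s :: "'a::cstar_algebra"
  assumes pair: "two_adic_pair u s"
begin

lemma rels:
  "star u * u = 1" "u * star u = 1" "star s * s = 1" "s * u = u * u * s"
  "s * star s + u * s * star s * star u = 1"
  using pair by (auto simp: two_adic_pair_def power2_eq_square)

lemma rels_assoc:
  "star u * (u * x) = x" "u * (star u * x) = x" "star s * (s * x) = x" "s * (u * x) = u * (u * (s * x))"
  using rels by (simp_all flip: mult.assoc)

text \<open>Conjugation by the unitary needs negative exponents as well,
  and the identities for range projections compare exponents of both signs.\<close>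

definition upow :: "int \<Rightarrow> 'a"
  where "upow m = (if m \<ge> 0 then u ^ nat m else star u ^ nat (- m))"

lemma upow_0 [simp]: "upow 0 = 1" and upow_1: "upow 1 = u"
  by (simp_all add: upow_def)

lemma upow_add_1: "upow (m + 1) = upow m * u"
proof (cases "m \<ge> 0")
  case True
  then have "nat (m + 1) = Suc (nat m)" by simp
  with True show ?thesis by (simp add: upow_def power_commutes)
next
  case False
  then obtain k where m: "m = - int (Suc k)" by (metis int_cases not_le of_nat_0_le_iff)
  have "upow m = star u ^ k * star u" by (simp add: upow_def m nat_add_distrib power_commutes)
  moreover have "upow (m + 1) = star u ^ k" by (cases k) (simp_all add: upow_def m nat_add_distrib)
  ultimately show ?thesis by (simp add: mult.assoc rels)
qed

lemma upow_diff_1: "upow (m - 1) = upow m * star u"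
  using upow_add_1[of "m - 1"] by (simp add: mult.assoc rels)

lemma upow_add: "upow (m + n) = upow m * upow n"
proof (induction n rule: int_induct[where k = 0])
  case (step1 n)
  have "upow (m + (n + 1)) = upow (m + n) * u" using upow_add_1[of "m + n"] by (simp add: add.assoc)
  then show ?case using step1 by (simp add: upow_add_1 mult.assoc)
next
  case (step2 n)
  have "upow (m + (n - 1)) = upow (m + n) * star u" using upow_diff_1[of "m + n"] by (simp add: algebra_simps)
  then show ?case using step2 by (simp add: upow_diff_1 mult.assoc)
qed simp

lemma upow_collect: "upow m * upow n = upow (m + n)" "upow m * (upow n * x) = upow (m + n) * x"
  by (simp_all add: upow_add mult.assoc)

lemma star_upow: "star (upow m) = upow (- m)"
  by (auto simp: upow_def star_power star_star)

lemma upow_isometry: "norm (upow m * x) = norm x"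
proof -
  have "(norm (upow m * x))\<^sup>2 = norm (star x * (star (upow m) * upow m) * x)"
    by (subst cstar_identity[symmetric]) (simp add: star_mult mult.assoc)
  also have "\<dots> = (norm x)\<^sup>2" by (simp add: star_upow upow_collect cstar_identity)
  finally show ?thesis by simp
qed

lemma upow_isometry_right: "norm (x * upow m) = norm x"
  using upow_isometry[of "- m" "star x"] norm_star[of "x * upow m"]
  by (simp add: star_mult star_upow norm_star)

lemma commute_upow:
  assumes "x * u = u * x"
  shows "x * upow m = upow m * x"
proof (induction m rule: int_induct[where k = 0])
  case (step1 m)
  then show ?case by (simp add: upow_add_1 mult.assoc flip: assms) (simp flip: mult.assoc)
next
  case (step2 m)
  have "x * star u = star u * u * x * star u" by (simp add: rels)
  also have "\<dots> = star u * (x * u) * star u" by (simp add: assms mult.assoc)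
  finally have "x * star u = star u * x" by (simp add: mult.assoc rels)
  then show ?case using step2 by (simp add: upow_diff_1 mult.assoc) (metis mult.assoc)
qed simp

text \<open>The ranges of \<open>s\<close> and \<open>u * s\<close> are orthogonal because the two range projections add up to \<open>1\<close>:
  compressing their sum by \<open>s\<close> leaves \<open>1\<close> plus a positive element of the form \<open>y * star y\<close>.\<close>

lemma star_s_u_s: "star s * (u * s) = 0"
proof -
  let ?y = "star s * (u * s)"
  have "star s * (s * star s + u * s * star s * star u) * s = 1" by (simp add: rels)
  then have "1 + ?y * star ?y = 1"
    by (simp add: distrib_left distrib_right star_mult star_star mult.assoc rels rels_assoc)
  then have "star (star ?y) * star ?y = 0" by (simp add: star_star)
  then have "(norm (star ?y))\<^sup>2 = 0" using cstar_identity[of "star ?y"] by simp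
  then show ?thesis by (simp add: norm_star)
qed

lemma s_upow: "s * upow m = upow (2 * m) * s"
proof (induction m rule: int_induct[where k = 0])
  case (step1 m)
  have "s * upow (m + 1) = upow (2 * m) * (s * u)" using step1 by (simp add: upow_add_1 flip: mult.assoc)
  also have "\<dots> = upow (2 * m + 1 + 1) * s" unfolding upow_add_1 rels by (simp add: mult.assoc)
  finally show ?case by (simp add: algebra_simps)
next
  case (step2 m)
  have "upow (2 * m) = upow (2 * m - 1 - 1) * u * u"
    using upow_add_1[of "2 * m - 1 - 1"] upow_add_1[of "2 * m - 1"] by simp
  then have "s * upow (m - 1) = upow (2 * m - 1 - 1) * (u * u * s) * star u"
    using step2 by (simp add: upow_diff_1) (simp flip: mult.assoc)
  also have "\<dots> = upow (2 * m - 1 - 1) * s" unfolding rels(4)[symmetric] by (simp add: mult.assoc rels(2))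
  finally show ?case by (simp add: algebra_simps)
qed simp

lemma spow_upow: "s ^ l * upow m = upow (2 ^ l * m) * s ^ l"
proof (induction l arbitrary: m)
  case (Suc l)
  have "s ^ Suc l * upow m = s * upow (2 ^ l * m) * s ^ l" by (simp add: mult.assoc Suc)
  then show ?case by (simp add: s_upow mult.assoc)
qed simp

lemma star_s_upow_s: "star s * (upow m * s) = (if even m then upow (m div 2) else 0)"
proof (cases "even m")
  case True
  then have "upow m * s = s * upow (m div 2)" by (simp add: s_upow)
  with True show ?thesis by (simp add: rels_assoc)
next
  case False
  then have m: "m = 1 + 2 * (m div 2)" by presburger
  have "upow m * s = u * s * upow (m div 2)"
    by (subst m) (simp only: upow_add upow_1 mult.assoc s_upow)
  then have "star s * (upow m * s) = star s * (u * s) * upow (m div 2)" by (simp add: mult.assoc)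
  with False show ?thesis by (simp add: star_s_u_s)
qed

text \<open>The model is \<open>L\<^sup>2\<close> of the circle, where \<open>u\<close> multiplies by the coordinate \<open>z\<close> and \<open>s\<close> substitutes
  \<open>z\<^sup>2\<close> for \<open>z\<close>. Compressing a power of \<open>z\<close> by the \<open>l\<close>-fold isometry averages it over the
  \<open>2\<^sup>l\<close>-th roots, which kills it unless the exponent is divisible by \<open>2\<^sup>l\<close>. For large \<open>l\<close> the
  compression therefore reads off the constant term of a trigonometric polynomial.\<close>

lemma compress_upow:
  "star (s ^ l) * (upow m * s ^ l) = (if 2 ^ l dvd m then upow (m div 2 ^ l) else 0)"
proof (induction l arbitrary: m)
  case (Suc l)
  have "star (s ^ Suc l) * (upow m * s ^ Suc l) = star (s ^ l) * ((star s * (upow m * s)) * s ^ l)"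
    by (simp add: star_mult mult.assoc)
  also have "\<dots> = (if 2 ^ Suc l dvd m then upow (m div 2 ^ Suc l) else 0)"
  proof (cases "even m")
    case True
    then obtain k where "m = 2 * k" by blast
    then show ?thesis by (simp add: star_s_upow_s Suc)
  next
    case False
    then have "\<not> 2 ^ Suc l dvd m" by (metis dvd_mult_left power_Suc)
    with False show ?thesis by (simp add: star_s_upow_s)
  qed
  finally show ?case .
qed simp

text \<open>Splitting the exponents below \<open>2\<^sup>l\<^sup>+\<^sup>1\<close> into \<open>r\<close> and \<open>2\<^sup>l + r\<close> reduces the claim for \<open>l + 1\<close> to the
  claim for \<open>l\<close>, since \<open>u ^ 2 ^ l * s ^ l = s ^ l * u\<close> turns each pair of terms into a copy of the defining
  relation between the ranges of \<open>s\<close> and \<open>u * s\<close>.\<close>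

lemma sum_ranges: "(\<Sum>r<2 ^ l. upow (int r) * (s ^ l * (star (s ^ l) * upow (- int r)))) = 1"
proof (induction l)
  case (Suc l)
  have *: "upow (int r) * (s ^ Suc l * (star (s ^ Suc l) * upow (- int r)))
      + upow (int (2 ^ l + r)) * (s ^ Suc l * (star (s ^ Suc l) * upow (- int (2 ^ l + r))))
      = upow (int r) * (s ^ l * (star (s ^ l) * upow (- int r)))" for r
  proof -
    have 1: "upow (int (2 ^ l + r)) * s ^ Suc l = upow (int r) * (s ^ l * (u * s))"
      using spow_upow[of l 1]
      by (simp add: upow_1 upow_add power_Suc2 add.commute[of "2 ^ l"] mult.assoc del: power_Suc)
        (simp flip: mult.assoc)
    have 2: "star (s ^ Suc l) * upow (- int (2 ^ l + r)) = star s * (star u * (star (s ^ l) * upow (- int r)))"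
      using arg_cong[OF 1, of star] by (simp add: star_mult star_upow mult.assoc)
    have 3: "s ^ Suc l = s ^ l * s" by (rule power_Suc2)
    have "upow (int r) * (s ^ Suc l * (star (s ^ Suc l) * upow (- int r)))
      + upow (int (2 ^ l + r)) * (s ^ Suc l * (star (s ^ Suc l) * upow (- int (2 ^ l + r))))
      = upow (int r) * s ^ l * (s * star s + u * s * star s * star u) * (star (s ^ l) * upow (- int r))"
      unfolding mult.assoc[of "upow (int (2 ^ l + r))", symmetric] 1 2
      by (simp add: 3 star_mult distrib_left distrib_right mult.assoc del: power_Suc)
    then show ?thesis unfolding rels mult_1_right by (simp only: mult.assoc)
  qed
  show ?case by (simp only: power_Suc sum_lessThan_double) (simp only: power_Suc[symmetric] * Suc)
qed (simp add: upow_collect)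

end

section \<open>Fejer means of trigonometric polynomials\<close>

lemma eventually_le_two_power: "\<forall>\<^sub>F l in sequentially. (m::int) \<le> 2 ^ l"
proof -
  have "m \<le> 2 ^ l" if "l \<ge> nat m" for l
  proof -
    have "m \<le> int l" using that by linarith
    also have "\<dots> < 2 ^ l" by (rule of_nat_less_two_power)
    finally show ?thesis by simp
  qed
  then show ?thesis by (auto simp: eventually_sequentially)
qed

text \<open>The Fejer weight \<open>max 0 (1 - \<bar>m\<bar> / K)\<close>. Up to the factor \<open>K\<close> it counts the pairs in \<open>{0..<K}\<close> with
  difference \<open>m\<close>, and in this form it enters twice: for Fourier series in the unitary, and for the gauge action.\<close>

definition fejer :: "nat \<Rightarrow> int \<Rightarrow> real"
  where "fejer K m = real (nat (int K - \<bar>m\<bar>)) / real K"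

lemma sum_differences:
  fixes a :: "'b::real_vector"
  shows "(\<Sum>r\<in>{0..<int K}. \<Sum>t\<in>{0..<int K}. if r - t = m then a else 0)
    = (real K * fejer K m) *\<^sub>R a"
proof -
  have "(\<Sum>t\<in>{0..<int K}. if r - t = m then a else 0) = (if r - m \<in> {0..<int K} then a else 0)" for r
  proof -
    have "(\<Sum>t\<in>{0..<int K}. if r - t = m then a else 0) = (\<Sum>t\<in>{0..<int K}. if t = r - m then a else 0)"
      by (rule sum.cong) auto
    then show ?thesis by simp
  qed
  then have "(\<Sum>r\<in>{0..<int K}. \<Sum>t\<in>{0..<int K}. if r - t = m then a else 0)
      = (\<Sum>r\<in>{0..<int K}. if r - m \<in> {0..<int K} then a else 0)" by simp
  also have "\<dots> = (\<Sum>r\<in>{max 0 m..<min (int K) (int K + m)}. a)"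
    by (rule sum.mono_neutral_cong_right) auto
  also have "\<dots> = real (nat (int K - \<bar>m\<bar>)) *\<^sub>R a"
    by (simp add: sum_constant_scaleR) (auto simp: max_def min_def)
  finally show ?thesis by (simp add: fejer_def)
qed

lemma fejer_le_1: "0 \<le> fejer K m" "fejer K m \<le> 1"
  by (auto simp: fejer_def divide_simps)

lemma fejer_0: "K > 0 \<Longrightarrow> fejer K 0 = 1"
  by (simp add: fejer_def)

lemma fejer_tendsto: "(\<lambda>K. fejer K m) \<longlonglongrightarrow> 1"
proof -
  have "(\<lambda>K. 1 - real_of_int \<bar>m\<bar> / real K) \<longlonglongrightarrow> 1 - 0"
    by (intro tendsto_diff tendsto_const lim_const_over_n)
  moreover have "\<forall>\<^sub>F K in sequentially. 1 - real_of_int \<bar>m\<bar> / real K = fejer K m"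
    using eventually_ge_at_top[of "nat \<bar>m\<bar> + 1"]
  proof eventually_elim
    case (elim K)
    then have "real (nat (int K - \<bar>m\<bar>)) = real K - real_of_int \<bar>m\<bar>" by simp
    with elim show ?case by (simp add: fejer_def field_simps)
  qed
  ultimately show ?thesis by (auto intro: Lim_transform_eventually)
qed

context two_adic
begin

text \<open>Trigonometric polynomials in the unitary. Building them up term by term lets properties that pass to
  sums be proved by induction.\<close>

inductive_set trig :: "'a set"
  where trig_0: "0 \<in> trig"
  | trig_add_upow: "p \<in> trig \<Longrightarrow> p + c *\<^sub>C upow m \<in> trig"

lemma trig_add: "q \<in> trig \<Longrightarrow> p \<in> trig \<Longrightarrow> p + q \<in> trig"
  by (induction q rule: trig.induct) (auto simp: intro: trig.intros simp flip: add.assoc)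

lemma trig_scaleC: "p \<in> trig \<Longrightarrow> c *\<^sub>C p \<in> trig"
  by (induction p rule: trig.induct) (auto simp: scaleC_add_right scaleC_scaleC intro: trig.intros)

lemma trig_upow: "upow m \<in> trig"
  using trig_add_upow[OF trig_0, of 1 m] by simp

lemma trig_sum: "(\<And>i. i \<in> I \<Longrightarrow> g i \<in> trig) \<Longrightarrow> sum g I \<in> trig"
  by (induction I rule: infinite_finite_induct) (auto intro: trig_0 trig_add)

lemma trig_induct [consumes 1, case_names zero upow add]:
  assumes "p \<in> trig" "P 0" "\<And>c m. P (c *\<^sub>C upow m)" "\<And>p q. P p \<Longrightarrow> P q \<Longrightarrow> P (p + q)"
  shows "P p"
  using assms(1) by (induction p rule: trig.induct) (use assms in auto)

lemma trig_subset_generated: "trig \<subseteq> cstar_generated {u}"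
proof -
  note sub = cstar_subalgebra_generated[of "{u}", unfolded cstar_subalgebra_def]
  have u: "u \<in> cstar_generated {u}" using cstar_generated_superset[of "{u}"] by simp
  then have star_u: "star u \<in> cstar_generated {u}" using sub by simp
  then have one: "1 \<in> cstar_generated {u}" using u sub rels(1) by metis
  have upow: "upow m \<in> cstar_generated {u}" for m
  proof (induction m rule: int_induct[where k = 0])
    case (step1 m)
    then show ?case using u sub by (simp add: upow_add_1)
  next
    case (step2 m)
    then show ?case using star_u sub by (simp add: upow_diff_1)
  qed (simp add: one)
  have "p \<in> cstar_generated {u}" if "p \<in> trig" for p
    using that by (induction rule: trig_induct) (use sub upow in auto)
  then show ?thesis by blast
qed

lemma closure_trig_subset_generated: "closure trig \<subseteq> cstar_generated {u}"
  using cstar_subalgebra_generated[of "{u}"]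
  by (intro closure_minimal trig_subset_generated) (simp add: cstar_subalgebra_def)

text \<open>The row \<open>Y\<close> satisfies \<open>Y * star Y = K * 1\<close> as soon as \<open>K \<le> 2\<^sup>l\<close>. Hence \<open>a \<mapsto> Y * a * star Y / K\<close> is a
  contraction, and it multiplies \<open>upow m\<close> by its Fejer weight when \<open>l\<close> is large. This produces Fejer means
  by operations inside the algebra.\<close>

definition fejer_row :: "nat \<Rightarrow> nat \<Rightarrow> 'a"
  where "fejer_row K l = (\<Sum>r\<in>{0..<int K}. upow r * (star (s ^ l) * upow (- r)))"

definition fejer_compress :: "nat \<Rightarrow> nat \<Rightarrow> 'a \<Rightarrow> 'a"
  where "fejer_compress K l a = (1 / real K) *\<^sub>R (fejer_row K l * a * star (fejer_row K l))"

text \<open>Expanding both rows gives a double sum whose entries contain the compressions of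
  \<open>upow (m - r + t)\<close>. The bound on \<open>l\<close> ensures that the only multiple of \<open>2\<^sup>l\<close> among these exponents is \<open>0\<close>.\<close>

lemma fejer_row_upow:
  assumes "\<bar>m\<bar> + int K \<le> 2 ^ l"
  shows "fejer_row K l * upow m * star (fejer_row K l) = (real K * fejer K m) *\<^sub>R upow m"
proof -
  have entry: "upow r * (star (s ^ l) * upow (- r)) * upow m * (upow t * (s ^ l * upow (- t)))
      = (if r - t = m then upow m else 0)" if "r \<in> {0..<int K}" "t \<in> {0..<int K}" for r t
  proof -
    have "upow r * (star (s ^ l) * upow (- r)) * upow m * (upow t * (s ^ l * upow (- t)))
        = upow r * (star (s ^ l) * (upow (m - r + t) * s ^ l)) * upow (- t)"
      by (simp add: mult.assoc upow_collect algebra_simps)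
    moreover have "2 ^ l dvd m - r + t \<longleftrightarrow> m - r + t = 0"
      using that assms zdvd_imp_le[of "2 ^ l" "\<bar>m - r + t\<bar>"] by fastforce
    ultimately show ?thesis by (simp add: compress_upow upow_collect) (auto simp: algebra_simps)
  qed
  have "star (fejer_row K l) = (\<Sum>t\<in>{0..<int K}. upow t * (s ^ l * upow (- t)))"
    by (simp add: fejer_row_def star_sum star_mult star_upow star_star mult.assoc)
  then have "fejer_row K l * upow m * star (fejer_row K l) = (\<Sum>r\<in>{0..<int K}. \<Sum>t\<in>{0..<int K}.
      upow r * (star (s ^ l) * upow (- r)) * upow m * (upow t * (s ^ l * upow (- t))))"
    by (simp only: fejer_row_def sum_distrib_right[of _ _ "upow m"] sum_product)
  also have "\<dots> = (\<Sum>r\<in>{0..<int K}. \<Sum>t\<in>{0..<int K}. if r - t = m then upow m else 0)"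
    by (intro sum.cong refl entry)
  finally show ?thesis by (simp only: sum_differences)
qed

lemma fejer_compress_upow:
  assumes "\<bar>m\<bar> + int K \<le> 2 ^ l"
  shows "fejer_compress K l (upow m) = fejer K m *\<^sub>R upow m"
  using fejer_row_upow[OF assms] by (cases "K = 0") (simp_all add: fejer_compress_def fejer_def)

lemma fejer_compress_add: "fejer_compress K l (a + b) = fejer_compress K l a + fejer_compress K l b"
  by (simp add: fejer_compress_def distrib_left distrib_right scaleR_add_right)

lemma fejer_compress_diff: "fejer_compress K l (a - b) = fejer_compress K l a - fejer_compress K l b"
  by (simp add: fejer_compress_def left_diff_distrib right_diff_distrib scaleR_diff_right)

lemma fejer_compress_scaleC: "fejer_compress K l (c *\<^sub>C a) = c *\<^sub>C fejer_compress K l a"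
  by (simp add: fejer_compress_def mult_scaleC_left mult_scaleC_right scaleC_scaleC mult.commute
      flip: scaleC_of_real)

lemma norm_fejer_compress_le:
  assumes "int K \<le> 2 ^ l"
  shows "norm (fejer_compress K l a) \<le> norm a"
proof (cases "K = 0")
  case False
  let ?Y = "fejer_row K l"
  have "?Y * star ?Y = real K *\<^sub>R 1"
    using fejer_row_upow[of 0 K l] assms False by (simp add: fejer_0)
  then have "(norm (star ?Y))\<^sup>2 = real K * norm (1 :: 'a)"
    by (subst cstar_identity[symmetric]) (simp add: star_star)
  also have "\<dots> \<le> real K * 1" by (intro mult_left_mono norm_one_le) simp
  finally have Y: "norm ?Y * norm ?Y \<le> real K" by (simp add: norm_star power2_eq_square)
  have "norm (?Y * a * star ?Y) \<le> norm ?Y * norm a * norm (star ?Y)"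
    by (meson norm_mult_ineq mult_right_mono norm_ge_zero order_trans)
  also have "\<dots> \<le> real K * norm a"
    using mult_right_mono[OF Y, of "norm a"] by (simp add: norm_star mult_ac)
  finally show ?thesis using False by (simp add: fejer_compress_def field_simps)
qed (simp add: fejer_compress_def)

lemma fejer_compress_trig_approx:
  assumes "p \<in> trig" "\<epsilon> > 0"
  shows "\<forall>\<^sub>F K in sequentially. \<forall>\<^sub>F l in sequentially. norm (fejer_compress K l p - p) < \<epsilon>"
  using assms
proof (induction arbitrary: \<epsilon> rule: trig_induct)
  case zero
  then show ?case by (simp add: fejer_compress_def)
next
  case (upow c m)
  have "(\<lambda>K. norm (c *\<^sub>C (fejer K m *\<^sub>R upow m - upow m))) \<longlonglongrightarrow> norm (c *\<^sub>C (1 *\<^sub>R upow m - upow m))"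
    by (intro tendsto_intros fejer_tendsto bounded_linear.tendsto[OF bounded_linear_scaleC])
  then have "\<forall>\<^sub>F K in sequentially. norm (c *\<^sub>C (fejer K m *\<^sub>R upow m - upow m)) < \<epsilon>"
    using upow by (intro order_tendstoD(2)) auto
  then show ?case
  proof eventually_elim
    case (elim K)
    have "\<forall>\<^sub>F l in sequentially. \<bar>m\<bar> + int K \<le> 2 ^ l" by (rule eventually_le_two_power)
    then show ?case
    proof eventually_elim
      case (elim l)
      then have "fejer_compress K l (c *\<^sub>C upow m) - c *\<^sub>C upow m = c *\<^sub>C (fejer K m *\<^sub>R upow m - upow m)"
        by (simp add: fejer_compress_scaleC fejer_compress_upow
            linear_diff[OF bounded_linear.linear[OF bounded_linear_scaleC]])
      with \<open>norm (c *\<^sub>C (fejer K m *\<^sub>R upow m - upow m)) < \<epsilon>\<close> show ?case by simp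
    qed
  qed
next
  case (add p q)
  from add(1)[of "\<epsilon> / 2"] add(2)[of "\<epsilon> / 2"] add(3)
  have "\<forall>\<^sub>F K in sequentially. (\<forall>\<^sub>F l in sequentially. norm (fejer_compress K l p - p) < \<epsilon> / 2) \<and>
    (\<forall>\<^sub>F l in sequentially. norm (fejer_compress K l q - q) < \<epsilon> / 2)"
    by (simp add: eventually_conj)
  then show ?case
  proof eventually_elim
    case (elim K)
    then have "\<forall>\<^sub>F l in sequentially. norm (fejer_compress K l p - p) < \<epsilon> / 2 \<and>
      norm (fejer_compress K l q - q) < \<epsilon> / 2" by (simp add: eventually_conj)
    then show ?case
    proof eventually_elim
      case (elim l)
      have "fejer_compress K l (p + q) - (p + q) = (fejer_compress K l p - p) + (fejer_compress K l q - q)"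
        by (simp add: fejer_compress_add)
      then have "norm (fejer_compress K l (p + q) - (p + q))
          \<le> norm (fejer_compress K l p - p) + norm (fejer_compress K l q - q)"
        by (simp only: norm_triangle_ineq)
      with elim show ?case by linarith
    qed
  qed
qed

lemma fejer_compress_shift_eq_0:
  assumes "p \<in> trig"
  shows "\<forall>\<^sub>F j in sequentially. \<forall>\<^sub>F l in sequentially. fejer_compress K l (upow (int j) * p) = 0"
  using assms
proof (induction rule: trig_induct)
  case (upow c m)
  have "\<forall>\<^sub>F j in sequentially. j \<ge> K + nat \<bar>m\<bar>" by (rule eventually_ge_at_top)
  then show ?case
  proof eventually_elim
    case (elim j)
    have "\<forall>\<^sub>F l in sequentially. \<bar>int j + m\<bar> + int K \<le> 2 ^ l" by (rule eventually_le_two_power)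
    then show ?case
    proof eventually_elim
      case (elim l)
      moreover have "fejer K (int j + m) = 0" using \<open>j \<ge> K + nat \<bar>m\<bar>\<close> by (simp add: fejer_def)
      ultimately show ?case
        by (simp add: mult_scaleC_right fejer_compress_scaleC upow_collect fejer_compress_upow)
    qed
  qed
next
  case (add p q)
  then have "\<forall>\<^sub>F j in sequentially. (\<forall>\<^sub>F l in sequentially. fejer_compress K l (upow (int j) * p) = 0) \<and>
    (\<forall>\<^sub>F l in sequentially. fejer_compress K l (upow (int j) * q) = 0)" by (simp add: eventually_conj)
  then show ?case
  proof eventually_elim
    case (elim j)
    then have "\<forall>\<^sub>F l in sequentially. fejer_compress K l (upow (int j) * p) = 0 \<and>
      fejer_compress K l (upow (int j) * q) = 0" by (simp add: eventually_conj)
    then show ?case by eventually_elim (simp add: distrib_left fejer_compress_add)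
  qed
qed (simp add: fejer_compress_def)

text \<open>A spectral statement in disguise: the spectrum of the unitary has no isolated points. The Fejer
  compression nearly fixes \<open>p\<close>, but annihilates \<open>upow j * p\<close> for large \<open>j\<close>, all of whose frequencies lie
  outside the window. So if arbitrarily large shifts of \<open>p\<close> are within \<open>\<delta>\<close> of \<open>p\<close>, then \<open>p\<close> has norm at
  most \<open>\<delta>\<close>.\<close>

lemma trig_norm_le_of_shifts:
  assumes p: "p \<in> trig" and J: "J > 0"
    and le: "\<And>k. norm (upow (int (J * k)) * p - p) \<le> \<delta>"
  shows "norm p \<le> \<delta>"
proof (rule field_le_epsilon)
  fix \<epsilon> :: real assume "\<epsilon> > 0"
  have "\<forall>\<^sub>F K in sequentially. \<forall>\<^sub>F l in sequentially. norm (fejer_compress K l p - p) < \<epsilon>"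
    by (rule fejer_compress_trig_approx[OF p \<open>\<epsilon> > 0\<close>])
  then obtain K where K: "\<forall>\<^sub>F l in sequentially. norm (fejer_compress K l p - p) < \<epsilon>"
    by (auto dest: eventually_happens)
  obtain j0 where j0: "\<And>j. j \<ge> j0 \<Longrightarrow> \<forall>\<^sub>F l in sequentially. fejer_compress K l (upow (int j) * p) = 0"
    using fejer_compress_shift_eq_0[OF p, of K] unfolding eventually_sequentially by blast
  let ?q = "upow (int (J * j0)) * p"
  have "J * j0 \<ge> j0" using J by simp
  from eventually_conj[OF K eventually_conj[OF j0[OF this] eventually_le_two_power[of "int K"]]]
  obtain l where l: "norm (fejer_compress K l p - p) < \<epsilon>" "fejer_compress K l ?q = 0" "int K \<le> 2 ^ l"
    by (auto dest: eventually_happens)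
  have "norm p \<le> norm (fejer_compress K l (?q - p)) + norm (fejer_compress K l p - p)"
    using norm_triangle_ineq4[of "fejer_compress K l p" "fejer_compress K l p - p"]
    by (simp add: fejer_compress_diff l(2) del: of_nat_mult)
  also have "\<dots> \<le> norm (?q - p) + \<epsilon>"
    using norm_fejer_compress_le[OF l(3)] l(1) by (intro add_mono) auto
  finally show "norm p \<le> \<delta> + \<epsilon>" using le[of j0] by simp
qed

end

section \<open>Homogeneous elements commuting with the unitary\<close>

text \<open>The degree is the number of factors \<open>s\<close> minus the number of factors \<open>star s\<close>. All relators are homogeneous,
  so this grading is the source of the gauge action.\<close>

fun letter_degree :: "letter \<Rightarrow> int"
  where "letter_degree LU = 0" | "letter_degree LU_star = 0"
  | "letter_degree LS = 1" | "letter_degree LS_star = - 1"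

definition word_degree :: "word \<Rightarrow> int"
  where "word_degree w = sum_list (map letter_degree (letters w))"

lemma word_degree_Cons: "word_degree (Word (x # ls)) = letter_degree x + word_degree (Word ls)"
  by (simp add: word_degree_def)

lemma word_degree_add: "word_degree (v + w) = word_degree v + word_degree w"
  by (simp add: word_degree_def plus_word_def)

lemma word_degree_star: "word_degree (word_star w) = - word_degree w"
proof -
  have "letter_degree (letter_star x) = - letter_degree x" for x by (cases x) auto
  then have "sum_list (map letter_degree (rev (map letter_star ls))) = - sum_list (map letter_degree ls)" for ls
    by (induction ls) auto
  then show ?thesis by (simp add: word_degree_def word_star_def)
qed

lemma word_degree_ge: "- int (length ls) \<le> word_degree (Word ls)"
proof (induction ls)
  case (Cons x ls)
  then show ?case by (cases x) (auto simp: word_degree_Cons)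
qed (simp add: word_degree_def)

lemma bounded_on_keys:
  fixes h :: "word \<Rightarrow> nat"
  obtains L where "\<And>w. w \<in> Poly_Mapping.keys f \<Longrightarrow> h w \<le> L"
proof
  show "h w \<le> Max (h ` Poly_Mapping.keys f)" if "w \<in> Poly_Mapping.keys f" for w
    using that by (intro Max_ge) auto
qed

definition homogeneous :: "int \<Rightarrow> free_alg \<Rightarrow> bool"
  where "homogeneous n f \<longleftrightarrow> (\<forall>w\<in>Poly_Mapping.keys f. word_degree w = n)"

lemma homogeneous_mult:
  assumes "homogeneous m f" "homogeneous n g"
  shows "homogeneous (m + n) (f * g)"
  unfolding homogeneous_def
proof
  fix w assume "w \<in> Poly_Mapping.keys (f * g)"
  then obtain v v' where "v \<in> Poly_Mapping.keys f" "v' \<in> Poly_Mapping.keys g" "w = v + v'"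
    using keys_mult[of f g] by blast
  then show "word_degree w = m + n" using assms by (simp add: homogeneous_def word_degree_add)
qed

lemma homogeneous_fstar: "homogeneous n f \<Longrightarrow> homogeneous (- n) (fstar f)"
  unfolding homogeneous_def
  by (metis in_keys_iff lookup_fstar complex_cnj_zero_iff word_degree_star minus_minus)

context two_adic
begin

lemma word_val_Cons: "word_val u s (Word (x # ls)) = letter_val u s x * word_val u s (Word ls)"
  by (simp add: word_val_def)

text \<open>Letters can be absorbed one by one: \<open>u\<close> and \<open>s\<close> only change the exponents, and \<open>star s\<close> either cancels an
  \<open>s\<close> (even exponent of \<open>u\<close>) or gives \<open>0\<close> (odd exponent). The bound on the length ensures that there is always
  an \<open>s\<close> left to cancel.\<close>

lemma word_val_upow_spow:
  assumes "length ls \<le> l"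
  shows "word_val u s (Word ls) * (upow a * s ^ l) = 0 \<or>
    (\<exists>m. word_val u s (Word ls) * (upow a * s ^ l) = upow m * s ^ nat (int l + word_degree (Word ls)))"
  using assms
proof (induction ls)
  case Nil
  show ?case by (auto simp: word_val_def word_degree_def)
next
  case (Cons x ls)
  let ?l = "nat (int l + word_degree (Word ls))"
  have l: "int ?l = int l + word_degree (Word ls)" "?l > 0"
    using word_degree_ge[of ls] Cons.prems by auto
  from Cons consider "word_val u s (Word ls) * (upow a * s ^ l) = 0"
    | m where "word_val u s (Word ls) * (upow a * s ^ l) = upow m * s ^ ?l" by auto
  then show ?case
  proof cases
    case 1
    then show ?thesis by (simp add: word_val_Cons mult.assoc)
  next
    case 2
    have w: "word_val u s (Word (x # ls)) * (upow a * s ^ l) = letter_val u s x * (upow m * s ^ ?l)"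
      by (simp add: word_val_Cons mult.assoc 2)
    show ?thesis
    proof (cases x)
      case LU
      have "u * (upow m * s ^ ?l) = upow (1 + m) * s ^ ?l" by (simp add: upow_add upow_1 mult.assoc)
      with LU show ?thesis unfolding w by (auto simp: word_degree_Cons)
    next
      case LU_star
      have "star u * (upow m * s ^ ?l) = upow (- 1 + m) * s ^ ?l"
        using star_upow[of 1] by (simp only: upow_add upow_1 mult.assoc)
      with LU_star show ?thesis unfolding w by (auto simp: word_degree_Cons)
    next
      case LS
      have "s * (upow m * s ^ ?l) = upow (2 * m) * s ^ Suc ?l"
        by (simp add: s_upow flip: mult.assoc)
      moreover have "nat (int l + word_degree (Word (x # ls))) = Suc ?l"
        using l LS by (simp add: word_degree_Cons)
      ultimately show ?thesis unfolding w using LS by auto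
    next
      case LS_star
      obtain k where k: "?l = Suc k" using l(2) by (cases ?l) auto
      have "star s * (upow m * s ^ ?l) = (star s * (upow m * s)) * s ^ k" by (simp add: k mult.assoc)
      moreover have "nat (int l + word_degree (Word (x # ls))) = k"
        using l(1) k LS_star by (simp add: word_degree_Cons)
      ultimately show ?thesis unfolding w using LS_star by (auto simp: star_s_upow_s)
    qed
  qed
qed

text \<open>Averaging over conjugation by powers of the unitary fixes everything that commutes with the unitary.
  It maps a word of degree \<open>0\<close> to a trigonometric polynomial once \<open>l\<close> is at least the length of the word.\<close>

definition conj_average :: "nat \<Rightarrow> 'a \<Rightarrow> 'a"
  where "conj_average l a = (1 / 2 ^ l) *\<^sub>R (\<Sum>r<2 ^ l. upow (int r) * a * upow (- int r))"

lemma conj_average_commute: "x * u = u * x \<Longrightarrow> conj_average l x = x"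
  by (simp add: conj_average_def commute_upow mult.assoc upow_collect flip: commute_upow)
    (simp add: sum_constant_scaleR)

lemma conj_average_diff: "conj_average l (a - b) = conj_average l a - conj_average l b"
  by (simp add: conj_average_def left_diff_distrib right_diff_distrib sum_subtractf scaleR_diff_right)

lemma conj_average_sum: "conj_average l (sum g I) = (\<Sum>i\<in>I. conj_average l (g i))"
proof (induction I rule: infinite_finite_induct)
  case (insert i I)
  have "conj_average l (a + b) = conj_average l a + conj_average l b" for a b
    by (simp add: conj_average_def distrib_left distrib_right sum.distrib scaleR_add_right)
  with insert show ?case by simp
qed (simp_all add: conj_average_def)

lemma conj_average_scaleC: "conj_average l (c *\<^sub>C a) = c *\<^sub>C conj_average l a"
  by (simp add: conj_average_def mult_scaleC_left mult_scaleC_right scaleC_scaleC mult.commute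
      flip: scaleC_of_real scaleC_sum_right)

lemma norm_conj_average_le: "norm (conj_average l a) \<le> norm a"
proof -
  have "norm (\<Sum>r<2 ^ l. upow (int r) * a * upow (- int r)) \<le> of_nat (card {..<2 ^ l :: nat}) * norm a"
    by (rule sum_norm_bound) (simp add: upow_isometry upow_isometry_right)
  then show ?thesis by (simp add: conj_average_def field_simps)
qed

text \<open>By \<open>sum_ranges\<close> a word of degree \<open>0\<close> is a sum of terms \<open>upow m * (s ^ l * star (s ^ l)) * upow (- a)\<close>.
  Averaging such a term replaces the range projection \<open>s ^ l * star (s ^ l)\<close> by the average of its conjugates,
  which is the scalar \<open>1 / 2\<^sup>l\<close>, again by \<open>sum_ranges\<close>.\<close>

lemma conj_average_word:
  assumes "word_degree w = 0" "length (letters w) \<le> l"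
  shows "conj_average l (word_val u s w) \<in> trig"
proof -
  let ?w = "word_val u s w"
  have piece: "(\<Sum>r<2 ^ l. upow (int r) * (?w * (upow a * s ^ l) * (star (s ^ l) * upow (- a))) * upow (- int r)) \<in> trig"
    for a
  proof (cases "?w * (upow a * s ^ l) = 0")
    case True
    then show ?thesis by (simp add: trig_0)
  next
    case False
    then obtain m where m: "?w * (upow a * s ^ l) = upow m * s ^ l"
      using word_val_upow_spow[of "letters w" l a] assms by auto
    have "upow (int r) * (?w * (upow a * s ^ l) * (star (s ^ l) * upow (- a))) * upow (- int r)
        = upow m * (upow (int r) * (s ^ l * (star (s ^ l) * upow (- int r)))) * upow (- a)" for r
      unfolding m by (simp add: mult.assoc upow_collect algebra_simps)
    then have "(\<Sum>r<2 ^ l. upow (int r) * (?w * (upow a * s ^ l) * (star (s ^ l) * upow (- a))) * upow (- int r))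
        = upow m * (\<Sum>r<2 ^ l. upow (int r) * (s ^ l * (star (s ^ l) * upow (- int r)))) * upow (- a)"
      by (simp only: sum_distrib_left sum_distrib_right)
    then show ?thesis unfolding sum_ranges by (simp add: upow_collect trig_upow)
  qed
  have "?w = ?w * (\<Sum>t<2 ^ l. upow (int t) * (s ^ l * (star (s ^ l) * upow (- int t))))"
    by (simp add: sum_ranges)
  also have "\<dots> = (\<Sum>t<2 ^ l. ?w * (upow (int t) * s ^ l) * (star (s ^ l) * upow (- int t)))"
    by (simp add: sum_distrib_left mult.assoc)
  finally have "conj_average l ?w = (\<Sum>t<2 ^ l. conj_average l (?w * (upow (int t) * s ^ l) * (star (s ^ l) * upow (- int t))))"
    using conj_average_sum by metis
  also have "\<dots> \<in> trig"
    unfolding conj_average_def scaleC_of_real[symmetric] by (intro trig_sum trig_scaleC piece)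
  finally show ?thesis .
qed

lemma conj_average_homogeneous:
  assumes "homogeneous 0 f"
  obtains l where "conj_average l (poly_val u s f) \<in> trig"
proof -
  obtain l where l: "\<And>w. w \<in> Poly_Mapping.keys f \<Longrightarrow> length (letters w) \<le> l"
    using bounded_on_keys[of f "\<lambda>w. length (letters w)"] by blast
  have "conj_average l (poly_val u s f)
      = (\<Sum>w\<in>Poly_Mapping.keys f. Poly_Mapping.lookup f w *\<^sub>C conj_average l (word_val u s w))"
    by (simp add: poly_val_def conj_average_sum conj_average_scaleC)
  also have "\<dots> \<in> trig"
    using assms l by (intro trig_sum trig_scaleC conj_average_word) (auto simp: homogeneous_def)
  finally show ?thesis by (rule that)
qed

text \<open>Limits of homogeneous polynomials of a fixed degree; in the universal algebra these subspaces are the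
  eigenspaces of the gauge action.\<close>

definition spectral_subspace :: "int \<Rightarrow> 'a set"
  where "spectral_subspace n = closure (poly_val u s ` {f. homogeneous n f})"

lemma spectral_subspace_approx:
  assumes "x \<in> spectral_subspace n" "\<epsilon> > 0"
  obtains f where "homogeneous n f" "norm (x - poly_val u s f) < \<epsilon>"
  using assms unfolding spectral_subspace_def closure_approachable
  by (auto simp: dist_norm norm_minus_commute)

lemma spectral_subspace_mult_star:
  assumes "x \<in> spectral_subspace n"
  shows "x * star x \<in> spectral_subspace 0"
proof -
  obtain X where X: "\<And>k. X k \<in> poly_val u s ` {f. homogeneous n f}" "X \<longlonglongrightarrow> x"
    using assms unfolding spectral_subspace_def closure_sequential by blast
  have "X k * star (X k) \<in> poly_val u s ` {f. homogeneous 0 f}" for k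
  proof -
    obtain f where f: "homogeneous n f" "X k = poly_val u s f" using X(1) by blast
    then have "X k * star (X k) = poly_val u s (f * fstar f)" by (simp add: poly_val_mult poly_val_fstar)
    moreover have "homogeneous 0 (f * fstar f)"
      using homogeneous_mult[OF f(1) homogeneous_fstar[OF f(1)]] by simp
    ultimately show ?thesis by blast
  qed
  moreover have "(\<lambda>k. X k * star (X k)) \<longlonglongrightarrow> x * star x"
    by (intro tendsto_mult X bounded_linear.tendsto[OF bounded_linear_star])
  ultimately show ?thesis unfolding spectral_subspace_def closure_sequential
    by (intro exI[of _ "\<lambda>k. X k * star (X k)"]) simp
qed

lemma spectral_subspace_star:
  assumes "x \<in> spectral_subspace n"
  shows "star x \<in> spectral_subspace (- n)"
proof -
  obtain X where X: "\<And>k. X k \<in> poly_val u s ` {f. homogeneous n f}" "X \<longlonglongrightarrow> x"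
    using assms unfolding spectral_subspace_def closure_sequential by blast
  have "star (X k) \<in> poly_val u s ` {f. homogeneous (- n) f}" for k
    using X(1)[of k] by (auto simp: homogeneous_fstar simp flip: poly_val_fstar)
  moreover have "(\<lambda>k. star (X k)) \<longlonglongrightarrow> star x"
    by (intro X bounded_linear.tendsto[OF bounded_linear_star])
  ultimately show ?thesis unfolding spectral_subspace_def closure_sequential
    by (intro exI[of _ "\<lambda>k. star (X k)"]) simp
qed

text \<open>The average over conjugates fixes \<open>x\<close> and moves an approximating polynomial of degree \<open>0\<close> into the
  trigonometric polynomials, without increasing its distance from \<open>x\<close>.\<close>

lemma commuting_degree_0:
  assumes x: "x \<in> spectral_subspace 0" and comm: "x * u = u * x"
  shows "x \<in> closure trig"
  unfolding closure_approachable
proof (intro allI impI)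
  fix \<epsilon> :: real assume "\<epsilon> > 0"
  obtain f where f: "homogeneous 0 f" "norm (x - poly_val u s f) < \<epsilon>"
    by (rule spectral_subspace_approx[OF x \<open>\<epsilon> > 0\<close>])
  obtain l where l: "conj_average l (poly_val u s f) \<in> trig"
    by (rule conj_average_homogeneous[OF f(1)])
  have "norm (conj_average l (x - poly_val u s f)) < \<epsilon>"
    using norm_conj_average_le f(2) by (rule le_less_trans)
  then have "dist (conj_average l (poly_val u s f)) x < \<epsilon>"
    by (simp add: conj_average_diff conj_average_commute[OF comm] dist_norm norm_minus_commute)
  with l show "\<exists>y\<in>trig. dist y x < \<epsilon>" by blast
qed

text \<open>The letter \<open>s\<close> doubles exponents of \<open>u\<close> and \<open>star s\<close> halves even ones, so a word scales all sufficiently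
  divisible exponents by two to the power of its degree.\<close>

lemma word_val_intertwines:
  "\<exists>a b. int b = int a + word_degree (Word ls) \<and>
    (\<forall>k. word_val u s (Word ls) * upow (2 ^ a * k) = upow (2 ^ b * k) * word_val u s (Word ls))"
proof (induction ls)
  case Nil
  show ?case by (auto simp: word_val_def word_degree_def)
next
  case (Cons x ls)
  then obtain a b where ab: "int b = int a + word_degree (Word ls)"
    "\<And>k. word_val u s (Word ls) * upow (2 ^ a * k) = upow (2 ^ b * k) * word_val u s (Word ls)" by blast
  have "\<exists>a b. int b = int a + letter_degree x \<and>
      (\<forall>k. letter_val u s x * upow (2 ^ a * k) = upow (2 ^ b * k) * letter_val u s x)"
  proof (cases x)
    case LU
    have "u * upow k = upow k * u" for k by (rule commute_upow) simp
    with LU show ?thesis by auto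
  next
    case LU_star
    have "star u * upow k = upow k * star u" for k by (rule commute_upow) (simp add: rels)
    with LU_star show ?thesis by auto
  next
    case LS
    then have "int 1 = int 0 + letter_degree x \<and>
        (\<forall>k. letter_val u s x * upow (2 ^ 0 * k) = upow (2 ^ 1 * k) * letter_val u s x)"
      by (simp add: s_upow)
    then show ?thesis by blast
  next
    case LS_star
    have "star s * upow (2 * k) = upow k * star s" for k
      using arg_cong[OF s_upow[of "- k"], of star] by (simp add: star_mult star_upow)
    with LS_star have "int 0 = int 1 + letter_degree x \<and>
        (\<forall>k. letter_val u s x * upow (2 ^ 1 * k) = upow (2 ^ 0 * k) * letter_val u s x)"
      by simp
    then show ?thesis by blast
  qed
  then obtain a' b' where ab': "int b' = int a' + letter_degree x"
    "\<And>k. letter_val u s x * upow (2 ^ a' * k) = upow (2 ^ b' * k) * letter_val u s x" by blast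
  have "word_val u s (Word (x # ls)) * upow (2 ^ (a' + a) * k)
      = upow (2 ^ (b' + b) * k) * word_val u s (Word (x # ls))" for k
  proof -
    have "word_val u s (Word (x # ls)) * upow (2 ^ (a' + a) * k)
        = letter_val u s x * (word_val u s (Word ls) * upow (2 ^ a * (2 ^ a' * k)))"
      by (simp add: word_val_Cons mult.assoc power_add mult.left_commute)
    also have "\<dots> = letter_val u s x * upow (2 ^ a' * (2 ^ b * k)) * word_val u s (Word ls)"
      unfolding ab(2) by (simp add: mult.assoc mult.left_commute)
    also have "\<dots> = upow (2 ^ (b' + b) * k) * word_val u s (Word (x # ls))"
      unfolding ab'(2) by (simp add: word_val_Cons mult.assoc power_add)
    finally show ?thesis .
  qed
  moreover have "int (b' + b) = int (a' + a) + word_degree (Word (x # ls))"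
    using ab(1) ab'(1) by (simp add: word_degree_Cons)
  ultimately show ?case by blast
qed

lemma homogeneous_intertwines:
  assumes "homogeneous (int n) f"
  obtains a where "\<And>k. poly_val u s f * upow (2 ^ a * k) = upow (2 ^ (a + n) * k) * poly_val u s f"
proof -
  have "\<exists>a. \<forall>k. word_val u s w * upow (2 ^ a * k) = upow (2 ^ (a + n) * k) * word_val u s w"
    if "w \<in> Poly_Mapping.keys f" for w
  proof -
    obtain a b where ab: "int b = int a + word_degree w"
      "\<And>k. word_val u s w * upow (2 ^ a * k) = upow (2 ^ b * k) * word_val u s w"
      using word_val_intertwines[of "letters w"] by auto
    moreover have "word_degree w = int n" using that assms by (simp add: homogeneous_def)
    ultimately have "b = a + n" by simp
    with ab(2) show ?thesis by blast
  qed
  then obtain a where a: "\<And>w k. w \<in> Poly_Mapping.keys f \<Longrightarrow>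
      word_val u s w * upow (2 ^ a w * k) = upow (2 ^ (a w + n) * k) * word_val u s w" by metis
  obtain A where A: "\<And>w. w \<in> Poly_Mapping.keys f \<Longrightarrow> a w \<le> A"
    using bounded_on_keys[of f a] by blast
  have "word_val u s w * upow (2 ^ A * k) = upow (2 ^ (A + n) * k) * word_val u s w"
    if w: "w \<in> Poly_Mapping.keys f" for w k
  proof -
    obtain j where j: "A = a w + j" using A[OF w] le_Suc_ex by blast
    show ?thesis using a[OF w, of "2 ^ j * k"] by (simp add: j power_add mult_ac)
  qed
  then have "poly_val u s f * upow (2 ^ A * k) = upow (2 ^ (A + n) * k) * poly_val u s f" for k
    by (simp add: poly_val_def sum_distrib_left sum_distrib_right mult_scaleC_left mult_scaleC_right)
  then show ?thesis by (rule that)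
qed

lemma commute_star:
  assumes "x * u = u * x"
  shows "star x * u = u * star x"
  using arg_cong[OF commute_upow[OF assms, of "- 1"], of star]
  by (simp add: star_mult star_upow upow_1)

text \<open>A polynomial \<open>y\<close> of degree \<open>n\<close> satisfies \<open>y * v = v\<^sup>N * y\<close> for \<open>N = 2\<^sup>n\<close> and all powers \<open>v\<close> of some
  \<open>u ^ 2 ^ a\<close>. If \<open>y\<close> is close to an \<open>x\<close> that commutes with \<open>v\<close>, then \<open>v\<^sup>N * x\<close> is close to \<open>v * x\<close>, so
  \<open>v\<^sup>N\<^sup>-\<^sup>1 * x\<close> is close to \<open>x\<close>; in the model on the circle, \<open>x\<close> is concentrated near the finitely many points
  at which \<open>v\<^sup>N\<^sup>-\<^sup>1\<close> takes the value \<open>1\<close>. The positive element \<open>x * star x\<close> inherits this, and it has degree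
  \<open>0\<close>, hence is a limit of trigonometric polynomials, to which \<open>trig_norm_le_of_shifts\<close> applies.\<close>

lemma commuting_positive_degree:
  assumes x: "x \<in> spectral_subspace (int n)" and n: "n > 0" and comm: "x * u = u * x"
  shows "x = 0"
proof -
  let ?g = "x * star x"
  have "?g * u = u * ?g" using comm commute_star[OF comm] by (metis mult.assoc)
  then have g: "?g \<in> closure trig"
    by (intro commuting_degree_0 spectral_subspace_mult_star[OF x])
  have le: "norm ?g \<le> \<epsilon> * (2 * norm x + 3)" if \<epsilon>: "\<epsilon> > 0" for \<epsilon>
  proof -
    obtain f where f: "homogeneous (int n) f" "norm (x - poly_val u s f) < \<epsilon>"
      by (rule spectral_subspace_approx[OF x \<epsilon>])
    let ?y = "poly_val u s f"
    obtain a where a: "\<And>k. ?y * upow (2 ^ a * k) = upow (2 ^ (a + n) * k) * ?y"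
      using homogeneous_intertwines[OF f(1)] by blast
    \<comment> \<open>\<open>J * k\<close> is the difference of the two exponents in the intertwining relation \<open>a\<close>.\<close>
    define J :: nat where "J = 2 ^ a * (2 ^ n - 1)"
    have "J > 0" using one_less_power[of "2::nat" n] n by (simp add: J_def)
    have J: "int (J * k) = 2 ^ (a + n) * int k - 2 ^ a * int k" for k
      by (simp add: J_def of_nat_diff power_add algebra_simps)
    have shift: "norm (upow (int (J * k)) * x - x) \<le> 2 * \<epsilon>" for k
    proof -
      let ?V = "upow (2 ^ a * int k)" and ?W = "upow (2 ^ (a + n) * int k)"
      have "norm (upow (int (J * k)) * x - x) = norm (?V * (upow (int (J * k)) * x - x))"
        by (simp add: upow_isometry)
      also have "?V * (upow (int (J * k)) * x - x) = ?W * x - x * ?V"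
        by (simp add: right_diff_distrib upow_collect J commute_upow[OF comm] del: of_nat_mult)
      also have "\<dots> = ?W * (x - ?y) - (x - ?y) * ?V"
        by (simp add: right_diff_distrib left_diff_distrib a)
      also have "norm \<dots> \<le> norm (x - ?y) + norm (x - ?y)"
        using norm_triangle_ineq4[of "?W * (x - ?y)" "(x - ?y) * ?V"]
        by (simp add: upow_isometry upow_isometry_right)
      finally show ?thesis using f(2) by simp
    qed
    obtain p where p: "p \<in> trig" "norm (?g - p) < \<epsilon>"
      using g \<epsilon> unfolding closure_approachable by (auto simp: dist_norm norm_minus_commute)
    have "norm p \<le> 2 * \<epsilon> * norm x + 2 * \<epsilon>"
    proof (rule trig_norm_le_of_shifts[OF p(1) \<open>J > 0\<close>])
      fix k
      let ?V = "upow (int (J * k))"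
      have "?V * p - p = (?V * x - x) * star x - ?V * (?g - p) + (?g - p)"
        by (simp add: right_diff_distrib left_diff_distrib mult.assoc)
      moreover have "norm (a - b + c) \<le> norm a + norm b + norm c" for a b c :: 'a
        by (meson add_right_mono norm_triangle_ineq norm_triangle_ineq4 order_trans)
      ultimately have "norm (?V * p - p) \<le> norm ((?V * x - x) * star x) + norm (?V * (?g - p)) + norm (?g - p)"
        by (simp only:)
      also have "\<dots> \<le> 2 * \<epsilon> * norm x + \<epsilon> + \<epsilon>"
      proof (intro add_mono)
        have "norm ((?V * x - x) * star x) \<le> norm (?V * x - x) * norm x"
          using norm_mult_ineq[of "?V * x - x" "star x"] by (simp add: norm_star)
        also have "\<dots> \<le> 2 * \<epsilon> * norm x" by (intro mult_right_mono shift) simp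
        finally show "norm ((?V * x - x) * star x) \<le> 2 * \<epsilon> * norm x" .
      qed (use p(2) in \<open>simp_all add: upow_isometry\<close>)
      finally show "norm (?V * p - p) \<le> 2 * \<epsilon> * norm x + 2 * \<epsilon>" by simp
    qed
    then show ?thesis using norm_triangle_ineq[of "?g - p" p] p(2) by (simp add: algebra_simps)
  qed
  have "norm ?g \<le> 0"
  proof (rule field_le_epsilon)
    fix \<delta> :: real assume "\<delta> > 0"
    have "2 * norm x + 3 > 0" using norm_ge_zero[of x] by linarith
    then show "norm ?g \<le> 0 + \<delta>" using le[of "\<delta> / (2 * norm x + 3)"] \<open>\<delta> > 0\<close> by simp
  qed
  then have "(norm (star x))\<^sup>2 = 0" using cstar_identity[of "star x"] by (simp add: star_star)
  then show ?thesis by (simp add: norm_star)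
qed

lemma commuting_nonzero_degree:
  assumes x: "x \<in> spectral_subspace n" and n: "n \<noteq> 0" and comm: "x * u = u * x"
  shows "x = 0"
proof (cases "n > 0")
  case True
  with x comm commuting_positive_degree[of x "nat n"] show ?thesis by simp
next
  case False
  with n commuting_positive_degree[OF _ _ commute_star[OF comm], of "nat (- n)"] spectral_subspace_star[OF x]
  have "star x = 0" by simp
  then show ?thesis using star_star[of x] by simp
qed

end

section \<open>The gauge action\<close>

text \<open>Degree-wise multipliers on the free algebra. The gauge automorphisms, the projections onto homogeneous
  components and the Fejer means along the degree are all of this form, which makes it possible to write the
  last two as combinations of the first.\<close>

lift_definition degree_mult :: "(int \<Rightarrow> complex) \<Rightarrow> free_alg \<Rightarrow> free_alg"
  is "\<lambda>m f w. m (word_degree w) * f w"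
  by (rule finite_subset[rotated]) auto

lemma lookup_degree_mult [simp]:
  "Poly_Mapping.lookup (degree_mult m f) w = m (word_degree w) * Poly_Mapping.lookup f w"
  by (simp add: degree_mult.rep_eq)

lemma degree_mult_add: "degree_mult m (f + g) = degree_mult m f + degree_mult m g"
  by (rule poly_mapping_eqI) (simp add: lookup_add algebra_simps)

lemma degree_mult_diff: "degree_mult m (f - g) = degree_mult m f - degree_mult m g"
  by (rule poly_mapping_eqI) (simp add: lookup_minus algebra_simps)

lemma degree_mult_fscale: "degree_mult m (fscale c f) = fscale c (degree_mult m f)"
  by (rule poly_mapping_eqI) simp

lemma degree_mult_single:
  "degree_mult m (Poly_Mapping.single w c) = Poly_Mapping.single w (m (word_degree w) * c)"
  by (rule poly_mapping_eqI) (simp add: lookup_single when_def)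

lemma degree_mult_0 [simp]: "degree_mult m 0 = 0"
  by (rule poly_mapping_eqI) simp

lemma degree_mult_mult:
  assumes "\<And>j k. m (j + k) = a j * b k"
  shows "degree_mult m (f * g) = degree_mult a f * degree_mult b g"
proof (induction f rule: free_alg_induct)
  case (single v c)
  show ?case
    by (induction g rule: free_alg_induct)
      (simp_all add: distrib_left degree_mult_add mult_single degree_mult_single word_degree_add assms mult_ac)
qed (simp_all add: distrib_right degree_mult_add)

lemma degree_mult_gen_LU:
  "degree_mult m (f * gen LU) = degree_mult m f * gen LU"
  "degree_mult m (gen LU * f) = gen LU * degree_mult m f"
proof -
  have U: "word_degree (Word [LU]) = 0" by (simp add: word_degree_def)
  show "degree_mult m (f * gen LU) = degree_mult m f * gen LU"
    by (induction f rule: free_alg_induct)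
      (simp_all add: gen_def distrib_right degree_mult_add mult_single degree_mult_single word_degree_add U)
  show "degree_mult m (gen LU * f) = gen LU * degree_mult m f"
    by (induction f rule: free_alg_induct)
      (simp_all add: gen_def distrib_left degree_mult_add mult_single degree_mult_single word_degree_add U)
qed

abbreviation gauge :: "real \<Rightarrow> free_alg \<Rightarrow> free_alg"
  where "gauge t \<equiv> degree_mult (\<lambda>n. cis (t * real_of_int n))"

lemma gauge_mult: "gauge t (f * g) = gauge t f * gauge t g"
  by (rule degree_mult_mult) (simp add: cis_mult distrib_left)

lemma gauge_fstar: "gauge t (fstar f) = fstar (gauge t f)"
  by (rule poly_mapping_eqI) (simp add: word_degree_star cis_cnj)

lemma gauge_gen: "gauge t (gen x) = fscale (cis (t * real_of_int (letter_degree x))) (gen x)"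
  by (simp add: gen_def degree_mult_single fscale_single word_degree_def)

lemma gauge_1: "gauge t 1 = 1"
  by (simp add: degree_mult_single word_degree_def zero_word_def flip: single_one)

lemma gauge_relators:
  assumes "r \<in> relators"
  shows "\<exists>c. gauge t r = fscale c r"
proof -
  have "gauge t r = fscale 1 r \<or> gauge t r = fscale (cis t) r"
    using assms unfolding relators_def
    by (auto simp: degree_mult_diff degree_mult_add gauge_mult gauge_gen gauge_1 power2_eq_square
        fscale_mult_left fscale_mult_right cis_mult fscale_diff_right)
  then show ?thesis by blast
qed

text \<open>Gauge automorphisms multiply each relator by a scalar, so they permute the admissible seminorms. This is the
  place where the universality of the algebra is used.\<close>

lemma admissible_gauge:
  assumes "admissible q"
  shows "admissible (\<lambda>f. q (gauge t f))"
proof -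
  from assms have q: "cstar_seminorm q" by (simp add: admissible_def)
  have "cstar_seminorm (\<lambda>f. q (gauge t f))"
    unfolding cstar_seminorm_def
    by (auto simp: degree_mult_add degree_mult_fscale gauge_mult gauge_fstar seminorm_nonneg[OF q]
        seminorm_triangle[OF q] seminorm_scale[OF q] seminorm_mult[OF q] seminorm_cstar[OF q])
  moreover have "q (gauge t r) = 0" if "r \<in> relators" for r
  proof -
    obtain c where "gauge t r = fscale c r" using gauge_relators \<open>r \<in> relators\<close> by blast
    then show ?thesis using assms that by (simp add: seminorm_scale[OF q] admissible_def)
  qed
  ultimately show ?thesis by (simp add: admissible_def)
qed

lemma universal_seminorm_gauge_le: "universal_seminorm (gauge t f) \<le> universal_seminorm f"
  by (rule universal_seminorm_leI)
    (rule admissible_le_universal[OF admissible_gauge])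

lemma universal_seminorm_degree_mult_le:
  assumes "\<And>w. w \<in> Poly_Mapping.keys f \<Longrightarrow>
    m (word_degree w) = (\<Sum>t\<in>I. b t * cis (\<theta> t * real_of_int (word_degree w)))"
  shows "universal_seminorm (degree_mult m f) \<le> (\<Sum>t\<in>I. cmod (b t)) * universal_seminorm f"
proof -
  have "degree_mult m f = (\<Sum>t\<in>I. fscale (b t) (gauge (\<theta> t) f))"
  proof (rule poly_mapping_eqI)
    fix w
    show "Poly_Mapping.lookup (degree_mult m f) w
      = Poly_Mapping.lookup (\<Sum>t\<in>I. fscale (b t) (gauge (\<theta> t) f)) w"
      using assms[of w]
      by (cases "w \<in> Poly_Mapping.keys f")
        (simp_all add: lookup_sum in_keys_iff sum_distrib_right mult.assoc)
  qed
  also have "universal_seminorm \<dots> \<le> (\<Sum>t\<in>I. universal_seminorm (fscale (b t) (gauge (\<theta> t) f)))"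
    by (rule seminorm_sum[OF cstar_seminorm_universal])
  also have "\<dots> \<le> (\<Sum>t\<in>I. cmod (b t) * universal_seminorm f)"
    by (intro sum_mono) (simp add: us_scale mult_left_mono universal_seminorm_gauge_le)
  finally show ?thesis by (simp add: sum_distrib_right)
qed

text \<open>Averages over finite groups of roots of unity can stand in for integrals over the circle, because a polynomial
  has only finitely many degrees and a large enough group tells them apart.\<close>

lemma sum_cis_roots_of_unity:
  fixes n :: int
  assumes M: "M > 0"
  shows "(\<Sum>t<M. cis (2 * pi * real t / real M * real_of_int n)) = (if int M dvd n then of_nat M else 0)"
proof -
  define z where "z = cis (2 * pi * real_of_int n / real M)"
  have z: "cis (2 * pi * real t / real M * real_of_int n) = z ^ t" for t
    unfolding z_def Complex.DeMoivre by (rule arg_cong[of _ _ cis]) (simp add: field_simps)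
  have zM: "z ^ M = 1" using M by (simp add: z_def Complex.DeMoivre cis_multiple_2pi)
  show ?thesis
  proof (cases "int M dvd n")
    case True
    then obtain k where "n = int M * k" by blast
    then have "z = 1"
      using M cis_multiple_2pi[of "real_of_int k"] by (simp add: z_def mult.assoc)
    then show ?thesis unfolding z using True by simp
  next
    case False
    have "z \<noteq> 1"
    proof
      assume "z = 1"
      then have "cos (2 * pi * real_of_int n / real M) = 1" by (simp add: z_def complex_eq_iff)
      then obtain j :: int where "2 * pi * real_of_int n / real M = real_of_int j * 2 * pi"
        unfolding cos_one_2pi_int by blast
      then have "real_of_int n = real_of_int (j * int M)" using M by (simp add: field_simps)
      then have "n = j * int M" by linarith
      with False show False by simp
    qed
    then show ?thesis unfolding z using False zM by (simp add: geometric_sum)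
  qed
qed

definition component :: "int \<Rightarrow> free_alg \<Rightarrow> free_alg"
  where "component n = degree_mult (\<lambda>k. if k = n then 1 else 0)"

lemma homogeneous_component: "homogeneous n (component n f)"
  by (auto simp: homogeneous_def component_def in_keys_iff split: if_splits)

text \<open>The projection onto degree \<open>n\<close> is an average of gauge automorphisms with unimodular weights.\<close>

lemma universal_seminorm_component_le: "universal_seminorm (component n f) \<le> universal_seminorm f"
proof -
  obtain D :: nat where D: "\<And>w. w \<in> Poly_Mapping.keys f \<Longrightarrow> \<bar>word_degree w\<bar> \<le> int D"
    using bounded_on_keys[of f "\<lambda>w. nat \<bar>word_degree w\<bar>"]
    by (metis nat_le_iff)
  define M where "M = D + nat \<bar>n\<bar> + 1"
  have M: "M > 0" by (simp add: M_def)
  define \<theta> where "\<theta> t = 2 * pi * real t / real M" for t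
  let ?b = "\<lambda>t. cis (\<theta> t * real_of_int (- n)) / of_nat M"
  \<comment> \<open>Any larger \<open>M\<close> would do: no degree of \<open>f\<close> other than \<open>n\<close> may be congruent to \<open>n\<close> modulo \<open>M\<close>.\<close>
  have "universal_seminorm (component n f) \<le> (\<Sum>t<M. cmod (?b t)) * universal_seminorm f"
    unfolding component_def
  proof (rule universal_seminorm_degree_mult_le)
    fix w assume "w \<in> Poly_Mapping.keys f"
    then have "\<bar>word_degree w - n\<bar> < int M" using D[of w] by (simp add: M_def)
    then have dvd: "int M dvd word_degree w - n \<longleftrightarrow> word_degree w = n"
      using dvd_imp_le_int[of "word_degree w - n" "int M"] by auto
    have "(\<Sum>t<M. ?b t * cis (\<theta> t * real_of_int (word_degree w)))
        = (\<Sum>t<M. cis (2 * pi * real t / real M * real_of_int (word_degree w - n))) / of_nat M"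
      unfolding sum_divide_distrib
      by (intro sum.cong refl) (simp add: cis_mult \<theta>_def algebra_simps diff_divide_distrib)
    also have "\<dots> = (if word_degree w = n then 1 else 0)"
      using M by (subst sum_cis_roots_of_unity) (simp_all add: dvd)
    finally show "(if word_degree w = n then 1 else 0)
      = (\<Sum>t<M. ?b t * cis (\<theta> t * real_of_int (word_degree w)))" by simp
  qed
  then show ?thesis using M by (simp add: norm_divide)
qed

definition fejer_mean :: "nat \<Rightarrow> free_alg \<Rightarrow> free_alg"
  where "fejer_mean K = degree_mult (\<lambda>n. complex_of_real (fejer K n))"

lemma cmod_sum_cis_power2:
  fixes I :: "int set"
  shows "complex_of_real ((cmod (\<Sum>r\<in>I. cis (x * real_of_int r)))\<^sup>2)
    = (\<Sum>r\<in>I. \<Sum>t\<in>I. cis (x * real_of_int (r - t)))"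
proof -
  have "complex_of_real ((cmod (\<Sum>r\<in>I. cis (x * real_of_int r)))\<^sup>2)
      = (\<Sum>r\<in>I. cis (x * real_of_int r)) * (\<Sum>r\<in>I. cis (- (x * real_of_int r)))"
    by (subst complex_norm_square) (simp add: cnj_sum cis_cnj)
  then show ?thesis by (simp add: sum_product cis_mult right_diff_distrib)
qed

text \<open>The Fejer mean along the degree is an average of gauge automorphisms whose weights \<open>F t\<close> are the values of the
  Fejer kernel at roots of unity. The kernel is a square, so the weights are nonnegative and their absolute
  values sum to the zeroth Fejer weight, which is \<open>1\<close>.\<close>

lemma universal_seminorm_fejer_mean_le:
  assumes K: "K > 0"
  shows "universal_seminorm (fejer_mean K f) \<le> universal_seminorm f"
proof -
  obtain D :: nat where D: "\<And>w. w \<in> Poly_Mapping.keys f \<Longrightarrow> \<bar>word_degree w\<bar> \<le> int D"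
    using bounded_on_keys[of f "\<lambda>w. nat \<bar>word_degree w\<bar>"]
    by (metis nat_le_iff)
  define M where "M = D + K"
  define \<theta> where "\<theta> t = 2 * pi * real t / real M" for t
  define F where "F t = (cmod (\<Sum>r\<in>{0..<int K}. cis (\<theta> t * real_of_int r)))\<^sup>2 / (real K * real M)" for t
  have M: "M > 0" using K by (simp add: M_def)
  have sum_F: "(\<Sum>t<M. complex_of_real (F t) * cis (\<theta> t * real_of_int n)) = complex_of_real (fejer K n)"
    if n: "\<bar>n\<bar> \<le> int D" for n
  proof -
    let ?I = "{0..<int K}"
    have "(\<Sum>t<M. complex_of_real (F t) * cis (\<theta> t * real_of_int n))
        = (\<Sum>t<M. \<Sum>r\<in>?I. \<Sum>r'\<in>?I. cis (2 * pi * real t / real M * real_of_int (r - r' + n))) / of_nat (K * M)"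
      unfolding sum_divide_distrib F_def of_real_divide cmod_sum_cis_power2 sum_distrib_right
      by (intro sum.cong refl) (simp add: cis_mult \<theta>_def distrib_left)
    also have "(\<Sum>t<M. \<Sum>r\<in>?I. \<Sum>r'\<in>?I. cis (2 * pi * real t / real M * real_of_int (r - r' + n)))
        = (\<Sum>r\<in>?I. \<Sum>r'\<in>?I. \<Sum>t<M. cis (2 * pi * real t / real M * real_of_int (r - r' + n)))"
      by (subst sum.swap, intro sum.cong refl, rule sum.swap)
    also have "\<dots> = (\<Sum>r\<in>?I. \<Sum>r'\<in>?I. if r - r' = - n then of_nat M else 0)"
    proof (intro sum.cong refl)
      fix r r' assume "r \<in> ?I" "r' \<in> ?I"
      then have "\<bar>r - r' + n\<bar> < int M" using n by (auto simp: M_def)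
      then have "int M dvd r - r' + n \<longleftrightarrow> r - r' + n = 0"
        using dvd_imp_le_int[of "r - r' + n" "int M"] by auto
      then have "int M dvd r - r' + n \<longleftrightarrow> r - r' = - n" by linarith
      then show "(\<Sum>t<M. cis (2 * pi * real t / real M * real_of_int (r - r' + n)))
          = (if r - r' = - n then of_nat M else 0)"
        using sum_cis_roots_of_unity[OF M, of "r - r' + n"] by simp
    qed
    also have "\<dots> = (real K * fejer K (- n)) *\<^sub>R of_nat M" by (rule sum_differences)
    also have "\<dots> / of_nat (K * M) = complex_of_real (fejer K n)"
      using K M by (simp add: fejer_def scaleR_conv_of_real)
    finally show ?thesis .
  qed
  have F: "F t \<ge> 0" for t by (simp add: F_def)
  have "universal_seminorm (fejer_mean K f) \<le> (\<Sum>t<M. cmod (complex_of_real (F t))) * universal_seminorm f"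
    unfolding fejer_mean_def by (rule universal_seminorm_degree_mult_le[where \<theta> = \<theta>]) (simp only: sum_F[OF D])
  moreover have "complex_of_real (\<Sum>t<M. F t) = 1"
    using sum_F[of 0] K by (simp add: fejer_0)
  then have "(\<Sum>t<M. F t) = 1" by (simp only: of_real_eq_1_iff)
  ultimately show ?thesis by (simp add: F)
qed

lemma fejer_mean_conv_components:
  "fejer_mean K f = (\<Sum>n\<in>{- int K..int K}. fscale (complex_of_real (fejer K n)) (component n f))"
proof (rule poly_mapping_eqI)
  fix w
  have "(\<Sum>n\<in>{- int K..int K}. Poly_Mapping.lookup (fscale (complex_of_real (fejer K n)) (component n f)) w)
      = (\<Sum>n\<in>{- int K..int K}. if n = word_degree w then complex_of_real (fejer K n) * Poly_Mapping.lookup f w else 0)"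
    by (intro sum.cong refl) (auto simp: component_def)
  also have "\<dots> = complex_of_real (fejer K (word_degree w)) * Poly_Mapping.lookup f w"
    by (auto simp: fejer_def)
  finally show "Poly_Mapping.lookup (fejer_mean K f) w = Poly_Mapping.lookup
      (\<Sum>n\<in>{- int K..int K}. fscale (complex_of_real (fejer K n)) (component n f)) w"
    by (simp add: lookup_sum fejer_mean_def)
qed

lemma fejer_mean_tendsto: "(\<lambda>K. universal_seminorm (f - fejer_mean K f)) \<longlonglongrightarrow> 0"
proof (rule tendsto_zero_le)
  let ?g = "\<lambda>K. \<Sum>w\<in>Poly_Mapping.keys f. cmod (Poly_Mapping.lookup f w) * (1 - fejer K (word_degree w))"
  have "?g \<longlonglongrightarrow> (\<Sum>w\<in>Poly_Mapping.keys f. cmod (Poly_Mapping.lookup f w) * (1 - 1))"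
    by (intro tendsto_intros fejer_tendsto)
  then show "?g \<longlonglongrightarrow> 0" by simp
  fix K
  let ?h = "f - fejer_mean K f"
  have h: "Poly_Mapping.lookup ?h w = complex_of_real (1 - fejer K (word_degree w)) * Poly_Mapping.lookup f w" for w
    by (simp add: lookup_minus fejer_mean_def algebra_simps)
  show "0 \<le> universal_seminorm ?h" by (rule us_nonneg)
  have "universal_seminorm ?h \<le> (\<Sum>w\<in>Poly_Mapping.keys ?h. cmod (Poly_Mapping.lookup ?h w))"
    by (rule admissible_le[OF admissible_universal])
  also have "\<dots> \<le> (\<Sum>w\<in>Poly_Mapping.keys f. cmod (Poly_Mapping.lookup ?h w))"
    by (rule sum_mono2) (auto simp: in_keys_iff h)
  also have "\<dots> = ?g K"
    by (intro sum.cong refl) (simp only: h norm_mult norm_of_real, simp add: fejer_le_1 mult.commute)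
  finally show "universal_seminorm ?h \<le> ?g K" .
qed

section \<open>The commutant of the unitary\<close>

interpretation Q2: two_adic Q2_U Q2_S
  by standard (rule two_adic_pair_Q2)

lemma emb_eq_poly_val: "emb f = poly_val Q2_U Q2_S f"
proof -
  have letter: "emb (gen x) = letter_val Q2_U Q2_S x" for x
    by (cases x) (simp_all add: star_gens, simp_all add: Q2_U_def Q2_S_def)
  have word: "emb (Poly_Mapping.single (Word ls) 1) = word_val Q2_U Q2_S (Word ls)" for ls
  proof (induction ls)
    case Nil
    show ?case using emb_hom(3) by (simp add: word_val_def zero_word_def flip: single_one)
  next
    case (Cons x ls)
    have "Poly_Mapping.single (Word (x # ls)) 1 = gen x * Poly_Mapping.single (Word ls) 1"
      by (simp add: gen_def mult_single plus_word_def)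
    then show ?case using Cons letter by (simp add: emb_hom word_val_def)
  qed
  show ?thesis
  proof (induction f rule: free_alg_induct)
    case (single w c)
    have "emb (Poly_Mapping.single w c) = emb (fscale c (Poly_Mapping.single (Word (letters w)) 1))"
      by (simp add: fscale_single)
    then show ?case using word[of "letters w"] by (simp only: emb_hom) (simp add: poly_val_single)
  qed (simp_all add: emb_hom poly_val_add)
qed

text \<open>The homogeneous components of an approximating sequence converge because taking components is contractive. It
  also commutes with multiplication by the unitary, which has degree \<open>0\<close>, so the limits still commute with it.\<close>

lemma component_limit:
  assumes X: "(\<lambda>k. emb (f k)) \<longlonglongrightarrow> x" and comm: "x * Q2_U = Q2_U * x"
  obtains y where "(\<lambda>k. emb (component n (f k))) \<longlonglongrightarrow> y" "y \<in> Q2.spectral_subspace n"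
    "y * Q2_U = Q2_U * y"
proof -
  have norm_le: "norm (emb (component n g)) \<le> norm (emb g)" for g
    by (simp add: norm_emb universal_seminorm_component_le)
  have "Cauchy (\<lambda>k. emb (component n (f k)))"
    unfolding Cauchy_iff
  proof (intro allI impI)
    fix e :: real assume "e > 0"
    then obtain N where N: "\<And>i j. i \<ge> N \<Longrightarrow> j \<ge> N \<Longrightarrow> norm (emb (f i) - emb (f j)) < e"
      using LIMSEQ_imp_Cauchy[OF X] unfolding Cauchy_iff by blast
    have "norm (emb (component n (f i)) - emb (component n (f j))) < e" if "i \<ge> N" "j \<ge> N" for i j
      using norm_le[of "f i - f j"] N[OF that]
      by (simp add: component_def degree_mult_diff emb_diff)
    then show "\<exists>N. \<forall>i\<ge>N. \<forall>j\<ge>N. norm (emb (component n (f i)) - emb (component n (f j))) < e" by blast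
  qed
  then obtain y where y: "(\<lambda>k. emb (component n (f k))) \<longlonglongrightarrow> y"
    using Cauchy_convergent convergent_def by blast
  have "y \<in> Q2.spectral_subspace n"
    unfolding Q2.spectral_subspace_def closure_sequential
    using y homogeneous_component by (intro exI[of _ "\<lambda>k. emb (component n (f k))"]) (auto simp: emb_eq_poly_val)
  moreover have "y * Q2_U = Q2_U * y"
  proof -
    let ?c = "\<lambda>k. f k * gen LU - gen LU * f k"
    have "(\<lambda>k. emb (f k) * Q2_U - Q2_U * emb (f k)) \<longlonglongrightarrow> x * Q2_U - Q2_U * x"
      by (intro tendsto_intros X)
    moreover have "emb (?c k) = emb (f k) * Q2_U - Q2_U * emb (f k)" for k
      by (simp add: emb_diff emb_hom Q2_U_def)
    ultimately have "(\<lambda>k. emb (?c k)) \<longlonglongrightarrow> 0"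
      by (simp only: comm diff_self)
    then have "(\<lambda>k. emb (component n (?c k))) \<longlonglongrightarrow> 0"
      by (rule Lim_null_comparison[OF always_eventually[rule_format, OF norm_le] tendsto_norm_zero])
    moreover have "emb (component n (?c k)) = emb (component n (f k)) * Q2_U - Q2_U * emb (component n (f k))" for k
      by (simp add: component_def degree_mult_diff degree_mult_gen_LU emb_diff emb_hom Q2_U_def)
    ultimately have "(\<lambda>k. emb (component n (f k)) * Q2_U - Q2_U * emb (component n (f k))) \<longlonglongrightarrow> 0"
      by simp
    moreover have "(\<lambda>k. emb (component n (f k)) * Q2_U - Q2_U * emb (component n (f k))) \<longlonglongrightarrow> y * Q2_U - Q2_U * y"
      by (intro tendsto_intros y)
    ultimately have "y * Q2_U - Q2_U * y = 0" by (rule LIMSEQ_unique[rotated])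
    then show ?thesis by simp
  qed
  ultimately show ?thesis using that y by blast
qed

text \<open>By the results on homogeneous elements, only the component \<open>x0\<close> of degree \<open>0\<close> survives, and it is a limit of
  trigonometric polynomials. All Fejer means of \<open>x\<close> along the degree are therefore equal to \<open>x0\<close>. Fejer means are
  contractive and converge on polynomials, so they converge to \<open>x\<close>; hence \<open>x = x0\<close>.\<close>

lemma commuting_in_closure_trig:
  assumes comm: "x * Q2_U = Q2_U * x"
  shows "x \<in> closure Q2.trig"
proof -
  obtain f where f: "(\<lambda>k. emb (f k)) \<longlonglongrightarrow> x"
  proof -
    obtain X where X: "Cauchy_seq X" "x = abs_two_adic_algebra X" by (rule two_adic_cases)
    have "(\<lambda>k. x - emb (X k)) \<longlonglongrightarrow> 0"
      using emb_tendsto[OF X(1)] X(2) by (simp add: tendsto_norm_zero_iff)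
    then have "(\<lambda>k. x - (x - emb (X k))) \<longlonglongrightarrow> x - 0" by (intro tendsto_diff tendsto_const)
    then show ?thesis using that[of X] by simp
  qed
  obtain x0 where x0: "(\<lambda>k. emb (component 0 (f k))) \<longlonglongrightarrow> x0" "x0 \<in> Q2.spectral_subspace 0"
    "x0 * Q2_U = Q2_U * x0"
    by (rule component_limit[OF f comm])
  have vanish: "(\<lambda>k. emb (component n (f k))) \<longlonglongrightarrow> 0" if "n \<noteq> 0" for n
  proof -
    obtain y where "(\<lambda>k. emb (component n (f k))) \<longlonglongrightarrow> y" "y \<in> Q2.spectral_subspace n"
      "y * Q2_U = Q2_U * y" by (rule component_limit[OF f comm])
    then show ?thesis using Q2.commuting_nonzero_degree[of y n] that by simp
  qed
  have means: "(\<lambda>k. emb (fejer_mean K (f k))) \<longlonglongrightarrow> x0" if K: "K > 0" for K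
  proof -
    have emb_sum: "emb (sum g I) = (\<Sum>i\<in>I. emb (g i))" for g and I :: "int set"
      by (induction I rule: infinite_finite_induct) (simp_all add: emb_hom)
    have "(\<lambda>k. complex_of_real (fejer K n) *\<^sub>C emb (component n (f k))) \<longlonglongrightarrow> (if n = 0 then x0 else 0)" for n
    proof (cases "n = 0")
      case True
      with x0(1) K show ?thesis by (simp add: fejer_0)
    next
      case False
      then show ?thesis using bounded_linear.tendsto[OF bounded_linear_scaleC vanish, of n "complex_of_real (fejer K n)"]
        by simp
    qed
    then have "(\<lambda>k. \<Sum>n\<in>{- int K..int K}. complex_of_real (fejer K n) *\<^sub>C emb (component n (f k)))
        \<longlonglongrightarrow> (\<Sum>n\<in>{- int K..int K}. if n = 0 then x0 else 0)"
      by (rule tendsto_sum)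
    then show ?thesis by (simp add: fejer_mean_conv_components emb_sum emb_hom)
  qed
  have "norm (x - x0) \<le> 0"
  proof (rule field_le_epsilon)
    fix \<epsilon> :: real assume "\<epsilon> > 0"
    then have \<epsilon>: "\<epsilon> / 3 > 0" by simp
    obtain N where N: "\<And>i j. i \<ge> N \<Longrightarrow> j \<ge> N \<Longrightarrow> norm (emb (f i) - emb (f j)) < \<epsilon> / 3"
      using LIMSEQ_imp_Cauchy[OF f] \<epsilon> unfolding Cauchy_iff by blast
    have "\<forall>\<^sub>F K in sequentially. universal_seminorm (f N - fejer_mean K (f N)) < \<epsilon> / 3 \<and> K > 0"
      by (intro eventually_conj order_tendstoD(2)[OF fejer_mean_tendsto \<epsilon>] eventually_gt_at_top)
    then obtain K where K: "universal_seminorm (f N - fejer_mean K (f N)) < \<epsilon> / 3" "K > 0"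
      by (auto dest: eventually_happens)
    have "norm (emb (f k) - emb (fejer_mean K (f k))) \<le> \<epsilon>" if "k \<ge> N" for k
    proof -
      have 1: "universal_seminorm (f k - f N) < \<epsilon> / 3"
        using N[OF that order_refl] by (simp add: norm_emb flip: emb_diff)
      then have 2: "universal_seminorm (fejer_mean K (f N) - fejer_mean K (f k)) < \<epsilon> / 3"
        using universal_seminorm_fejer_mean_le[OF K(2), of "f N - f k"]
        by (simp add: fejer_mean_def degree_mult_diff us_minus_commute)
      show ?thesis
        using 1 2 K(1) us_triangle_diff[of "f k" "fejer_mean K (f k)" "f N"]
          us_triangle_diff[of "f N" "fejer_mean K (f k)" "fejer_mean K (f N)"]
        by (simp add: norm_emb flip: emb_diff)
    qed
    moreover have "(\<lambda>k. norm (emb (f k) - emb (fejer_mean K (f k)))) \<longlonglongrightarrow> norm (x - x0)"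
      by (intro tendsto_intros f means K)
    ultimately show "norm (x - x0) \<le> 0 + \<epsilon>"
      by (intro LIMSEQ_le_const2) auto
  qed
  then show ?thesis using Q2.commuting_degree_0[OF x0(2,3)] by simp
qed

theorem theorem3p4:
  shows "maximal_abelian_cstar_subalgebra (cstar_generated {Q2_U})"
  unfolding maximal_abelian_cstar_subalgebra_def
proof (intro conjI allI impI)
  show "abelian_cstar_subalgebra (cstar_generated {Q2_U})"
    by (rule abelian_cstar_generated) (simp add: Q2.rels)
  fix C assume C: "abelian_cstar_subalgebra C \<and> cstar_generated {Q2_U} \<subseteq> C"
  then have "Q2_U \<in> C" using cstar_generated_superset[of "{Q2_U}"] by blast
  with C have "x * Q2_U = Q2_U * x" if "x \<in> C" for x
    using that by (simp add: abelian_cstar_subalgebra_def)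
  then have "C \<subseteq> cstar_generated {Q2_U}"
    using commuting_in_closure_trig Q2.closure_trig_subset_generated by blast
  with C show "C = cstar_generated {Q2_U}" by blast
qed

end
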